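(* Let $(C_{\varphi_t})_{t\ge0}$ be an immediately compact analytic semigroup of composition operators on $H^2(\mathbb{D})$ or $\mathcal{D}$. Then the following conditions are equivalent: 1. There exists a $t_0>0$ such that $\|\varphi_{t_0}\|_\infty<1$; 2. For all $t>0$ one has $\|\varphi_t\|_\infty<1$. Therefore, if there exists a $t_0>0$ such that $\|\varphi_{t_0}\|_\infty<1$, then $(C_{\varphi_t})_{t\ge0}$ is immediately trace-class.
   Context: $\mathbb{D}$ is the open unit disc. $H^2(\mathbb{D})$ is the Hilbert space of analytic $f(z)=\sum_{n\ge0}c_nz^n$ on $\mathbb{D}$ with $\|f\|^2=\sum_{n\ge 0}|c_n|^2<\infty$; $\mathcal{D}$ is the Dirichlet space, with $\|f\|^2=|c_0|^2+\sum_{n\ge1}n|c_n|^2<\infty$. $\|\varphi\|_\infty=\sup_{z\in\mathbb{D}}|\varphi(z)|$, and $C_\varphi f=f\circ\varphi$ for $\varphi:\mathbb{D}\to\mathbb{D}$ analytic. Here $(\varphi_t)_{t\ge0}$ is a semiflow: $\varphi_t:\mathbb{D}\to\mathbb{D}$ analytic, $\varphi_0=\mathrm{id}$, $\varphi_{s+t}=\varphi_s\circ\varphi_t$, $(t,z)\mapsto\varphi_t(z)$ jointly continuous. A $C_0$-semigroup $(T(t))_{t\ge0}$ on a Banach space $X$ is a family of bounded operators with $T(0)=I$, $T(t+s)=T(t)T(s)$ and $\lim_{t\to0}T(t)x=x$ for all $x\in X$. For $\theta\in(0,\pi/2]$ put $\Sigma_\theta=\{re^{i\alpha}: r\ge 0,\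 |\alpha|<\theta\}$. The $C_0$-semigroup $T$ is analytic if for some $\theta\in(0,\pi/2]$ it has an extension $\widetilde T:\Sigma_\theta\to\mathcal{L}(X)$ which is analytic (on $\Sigma_\theta\setminus\{0\}$) and satisfies $\sup_{\xi\in\Sigma_\theta\cap\mathbb{D}}\|\widetilde T(\xi)\|<\infty$. A semigroup is immediately compact (respectively immediately trace-class) if $T(t)$ is compact (respectively trace-class) for all $t>0$. *)

theory Defs
  imports "HOL-Complex_Analysis.Complex_Analysis"
begin

section \<open>Operators on complex Hilbert spaces\<close>

class complex_hilbert = real_inner + complete_space +
  fixes scaleC :: "complex \<Rightarrow> 'a \<Rightarrow> 'a"
    and cinner :: "'a \<Rightarrow> 'a \<Rightarrow> complex"
  assumes scaleC_add_right: "scaleC a (x + y) = scaleC a x + scaleC a y"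
    and scaleC_add_left: "scaleC (a + b) x = scaleC a x + scaleC b x"
    and scaleC_scaleC: "scaleC a (scaleC b x) = scaleC (a * b) x"
    and scaleC_one: "scaleC 1 x = x"
    and scaleR_scaleC: "r *\<^sub>R x = scaleC (complex_of_real r) x"
    and cinner_add_left: "cinner (x + y) z = cinner x z + cinner y z"
    and cinner_scaleC_left: "cinner (scaleC a x) y = a * cinner x y"
    and cinner_commute: "cinner y x = cnj (cinner x y)"
    and inner_cinner: "inner x y = Re (cinner x y)"

lemma norm_scaleC: "norm (scaleC a (x :: 'a::complex_hilbert)) = cmod a * norm x"
proof -
  have "cinner (scaleC a x) (scaleC a x) = a * cnj a * cinner x x"
    by (metis cinner_commute cinner_scaleC_left complex_cnj_mult mult.assoc)
  also have "a * cnj a = of_real ((cmod a)\<^sup>2)"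
    by (simp only: complex_norm_square)
  finally have "inner (scaleC a x) (scaleC a x) = (cmod a)\<^sup>2 * inner x x"
    by (simp add: inner_cinner)
  then show ?thesis by (simp add: norm_eq_sqrt_inner real_sqrt_mult)
qed

lemma bounded_linear_scaleC: "bounded_linear (scaleC a :: 'a \<Rightarrow> 'a::complex_hilbert)"
  by (rule bounded_linear_intro[of _ "cmod a"])
     (simp_all add: scaleC_add_right scaleR_scaleC scaleC_scaleC norm_scaleC mult.commute)

definition bounded_operator :: "('a::complex_hilbert \<Rightarrow> 'a) \<Rightarrow> bool" where
  "bounded_operator T \<longleftrightarrow> bounded_linear T \<and> (\<forall>a x. T (scaleC a x) = scaleC a (T x))"

definition compact_operator :: "('a::complex_hilbert \<Rightarrow> 'a) \<Rightarrow> bool" where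
  "compact_operator T \<longleftrightarrow>
     bounded_operator T \<and> (\<forall>B. bounded B \<longrightarrow> compact (closure (T ` B)))"

definition positive_operator :: "('a::complex_hilbert \<Rightarrow> 'a) \<Rightarrow> bool" where
  "positive_operator A \<longleftrightarrow>
     bounded_operator A \<and> (\<forall>x. Im (cinner (A x) x) = 0 \<and> 0 \<le> Re (cinner (A x) x))"

definition adjoint_operator :: "('a::complex_hilbert \<Rightarrow> 'a) \<Rightarrow> ('a \<Rightarrow> 'a) \<Rightarrow> bool" where
  "adjoint_operator T S \<longleftrightarrow> bounded_operator S \<and> (\<forall>x y. cinner (T x) y = cinner x (S y))"

definition absolute_value :: "('a::complex_hilbert \<Rightarrow> 'a) \<Rightarrow> ('a \<Rightarrow> 'a) \<Rightarrow> bool" where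
  "absolute_value T A \<longleftrightarrow>
     positive_operator A \<and> (\<exists>S. adjoint_operator T S \<and> A \<circ> A = S \<circ> T)"

definition orthonormal_basis :: "'a::complex_hilbert set \<Rightarrow> bool" where
  "orthonormal_basis B \<longleftrightarrow>
     (\<forall>x\<in>B. \<forall>y\<in>B. cinner x y = (if x = y then 1 else 0)) \<and>
     (\<forall>x. (\<forall>y\<in>B. cinner x y = 0) \<longrightarrow> x = 0)"

text \<open>
  The trace \<open>\<Sum>e\<in>B. \<langle>|T| e, e\<rangle>\<close> is a sum of nonnegative terms whose value in
  \<open>[0, \<infinity>]\<close> does not depend on the orthonormal basis \<open>B\<close>.
\<close>

definition trace_class :: "('a::complex_hilbert \<Rightarrow> 'a) \<Rightarrow> bool" where
  "trace_class T \<longleftrightarrow> bounded_operator T \<and>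
     (\<exists>A B. absolute_value T A \<and> orthonormal_basis B \<and>
            (\<lambda>e. Re (cinner (A e) e)) summable_on B)"


section \<open>Operator semigroups\<close>

text \<open>Semigroups are functions on \<open>real\<close>; only their values at \<open>t \<ge> 0\<close> matter.\<close>

definition C0_semigroup :: "(real \<Rightarrow> 'a::complex_hilbert \<Rightarrow> 'a) \<Rightarrow> bool" where
  "C0_semigroup T \<longleftrightarrow>
     (\<forall>t\<ge>0. bounded_operator (T t)) \<and>
     T 0 = id \<and>
     (\<forall>s\<ge>0. \<forall>t\<ge>0. T (t + s) = T t \<circ> T s) \<and>
     (\<forall>x. ((\<lambda>t. T t x) \<longlongrightarrow> x) (at_right 0))"

definition sector :: "real \<Rightarrow> complex set" where
  "sector \<theta> = {of_real r * cis \<alpha> | r \<alpha>. 0 \<le> r \<and> \<bar>\<alpha>\<bar> < \<theta>}"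

text \<open>
  Norm analyticity of a map into the bounded operators: its real Frechet derivative at
  every point \<open>z\<close> is \<open>h \<mapsto> h D\<close> for some bounded operator \<open>D\<close>.
\<close>

definition operator_analytic_on ::
    "(complex \<Rightarrow> 'a::complex_hilbert \<Rightarrow>\<^sub>L 'a) \<Rightarrow> complex set \<Rightarrow> bool" where
  "operator_analytic_on S U \<longleftrightarrow>
     (\<forall>z\<in>U. \<exists>D. bounded_operator (blinfun_apply D) \<and>
        (S has_derivative (\<lambda>h. Blinfun (\<lambda>x. scaleC h (D x)))) (at z))"

definition analytic_semigroup :: "(real \<Rightarrow> 'a::complex_hilbert \<Rightarrow> 'a) \<Rightarrow> bool" where
  "analytic_semigroup T \<longleftrightarrow> C0_semigroup T \<and>
     (\<exists>\<theta> S. 0 < \<theta> \<and> \<theta> \<le> pi / 2 \<and>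
        (\<forall>\<xi>\<in>sector \<theta>. bounded_operator (blinfun_apply (S \<xi>))) \<and>
        (\<forall>t\<ge>0. blinfun_apply (S (of_real t)) = T t) \<and>
        operator_analytic_on S (sector \<theta> - {0}) \<and>
        bdd_above ((\<lambda>\<xi>. norm (S \<xi>)) ` (sector \<theta> \<inter> ball 0 1)))"

definition immediately_compact :: "(real \<Rightarrow> 'a::complex_hilbert \<Rightarrow> 'a) \<Rightarrow> bool" where
  "immediately_compact T \<longleftrightarrow> (\<forall>t>0. compact_operator (T t))"

definition immediately_trace_class :: "(real \<Rightarrow> 'a::complex_hilbert \<Rightarrow> 'a) \<Rightarrow> bool" where
  "immediately_trace_class T \<longleftrightarrow> (\<forall>t>0. trace_class (T t))"


section \<open>Semiflows and composition operators\<close>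

definition semiflow :: "(real \<Rightarrow> complex \<Rightarrow> complex) \<Rightarrow> bool" where
  "semiflow \<phi> \<longleftrightarrow>
     (\<forall>t\<ge>0. \<phi> t holomorphic_on ball 0 1 \<and> \<phi> t ` ball 0 1 \<subseteq> ball 0 1) \<and>
     (\<forall>z\<in>ball 0 1. \<phi> 0 z = z) \<and>
     (\<forall>s\<ge>0. \<forall>t\<ge>0. \<forall>z\<in>ball 0 1. \<phi> (s + t) z = \<phi> s (\<phi> t z)) \<and>
     continuous_on ({0..} \<times> ball 0 1) (\<lambda>(t, z). \<phi> t z)"

definition disc_sup_norm :: "(complex \<Rightarrow> complex) \<Rightarrow> real" where
  "disc_sup_norm f = (SUP z\<in>ball 0 1. cmod (f z))"

text \<open>
  \<open>T\<close> is the operator \<open>f \<mapsto> f \<circ> \<phi>\<close>, where \<open>ev\<close> sends an element of the space to the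
  function it represents.  Such a \<open>T\<close> exists iff \<open>f \<circ> \<phi>\<close> lies in the space for every \<open>f\<close>
  in it, and is then unique.
\<close>

definition composition_operator ::
    "('a \<Rightarrow> complex \<Rightarrow> complex) \<Rightarrow> (complex \<Rightarrow> complex) \<Rightarrow> ('a \<Rightarrow> 'a) \<Rightarrow> bool" where
  "composition_operator ev \<phi> T \<longleftrightarrow> (\<forall>f. \<forall>z\<in>ball 0 1. ev (T f) z = ev f (\<phi> z))"


section \<open>Analytic functions on the disc and their Taylor coefficients\<close>

text \<open>Functions on the disc are represented by their extension by \<open>0\<close>.\<close>

definition disc_analytic :: "(complex \<Rightarrow> complex) set" where
  "disc_analytic = {f. f holomorphic_on ball 0 1 \<and> (\<forall>z. z \<notin> ball 0 1 \<longrightarrow> f z = 0)}"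

definition taylor_coeff :: "(complex \<Rightarrow> complex) \<Rightarrow> nat \<Rightarrow> complex" where
  "taylor_coeff f n = (deriv ^^ n) f 0 / fact n"

lemma disc_analytic_zero: "(\<lambda>_. 0) \<in> disc_analytic"
  by (simp add: disc_analytic_def)

lemma disc_analytic_add:
  "f \<in> disc_analytic \<Longrightarrow> g \<in> disc_analytic \<Longrightarrow> (\<lambda>z. f z + g z) \<in> disc_analytic"
  by (auto simp: disc_analytic_def intro: holomorphic_intros)

lemma disc_analytic_cmult:
  "f \<in> disc_analytic \<Longrightarrow> (\<lambda>z. a * f z) \<in> disc_analytic"
  by (auto simp: disc_analytic_def intro: holomorphic_intros)

lemma taylor_coeff_cmult:
  assumes "f \<in> disc_analytic"
  shows "taylor_coeff (\<lambda>z. a * f z) n = a * taylor_coeff f n"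
proof -
  have "(deriv ^^ n) (\<lambda>z. a * f z) 0 = a * (deriv ^^ n) f 0"
    by (rule higher_deriv_cmult[of _ "ball 0 1"]) (use assms in \<open>auto simp: disc_analytic_def\<close>)
  then show ?thesis by (simp add: taylor_coeff_def)
qed

lemma taylor_coeff_add:
  assumes "f \<in> disc_analytic" "g \<in> disc_analytic"
  shows "taylor_coeff (\<lambda>z. f z + g z) n = taylor_coeff f n + taylor_coeff g n"
proof -
  have "(deriv ^^ n) (\<lambda>z. f z + g z) 0 = (deriv ^^ n) f 0 + (deriv ^^ n) g 0"
    by (rule higher_deriv_add[of _ "ball 0 1"]) (use assms in \<open>auto simp: disc_analytic_def\<close>)
  then show ?thesis by (simp add: taylor_coeff_def add_divide_distrib)
qed

lemma taylor_coeff_zero: "taylor_coeff (\<lambda>_. 0) n = 0"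
  using taylor_coeff_cmult[OF disc_analytic_zero, of 0 n] by simp

lemma taylor_coeff_sums:
  assumes "f \<in> disc_analytic" "z \<in> ball 0 1"
  shows "(\<lambda>n. taylor_coeff f n * z ^ n) sums f z"
  using holomorphic_power_series[of f 0 1 z] assms
  by (auto simp: disc_analytic_def taylor_coeff_def)

lemma disc_analytic_eq_zeroI:
  assumes f: "f \<in> disc_analytic" and z: "\<And>n. taylor_coeff f n = 0"
  shows "f = (\<lambda>_. 0)"
proof
  fix x
  show "f x = 0"
  proof (cases "x \<in> ball 0 1")
    case True
    from taylor_coeff_sums[OF f this] have "(\<lambda>n. 0) sums f x" by (simp add: z)
    then show ?thesis using sums_0 sums_unique2 by blast
  next
    case False
    with f show ?thesis by (simp add: disc_analytic_def)
  qed
qed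

lemma taylor_coeff_realize:
  fixes c :: "nat \<Rightarrow> complex"
  assumes bd: "\<And>n. cmod (c n) \<le> K"
  shows "\<exists>f. f \<in> disc_analytic \<and> (\<forall>n. taylor_coeff f n = c n)"
proof -
  define f where "f = (\<lambda>z. if z \<in> ball 0 1 then (\<Sum>n. c n * z ^ n) else 0)"
  have sm: "(\<lambda>n. c n * z ^ n) sums f z" if "z \<in> ball 0 1" for z
  proof -
    have "summable (\<lambda>n. K * cmod z ^ n)"
      using that by (intro summable_mult summable_geometric) simp
    then have "summable (\<lambda>n. c n * z ^ n)"
      by (rule summable_comparison_test') (auto simp: norm_mult norm_power intro!: mult_right_mono bd)
    then show ?thesis using that by (simp add: f_def summable_sums)
  qed
  have hol: "f holomorphic_on ball 0 1"
    by (rule power_series_holomorphic[of 0 1 c]) (use sm in auto)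
  have "f has_fps_expansion Abs_fps c"
    by (rule has_fps_expansionI)
       (auto intro!: eventually_mono[OF eventually_nhds_in_open[of "ball 0 1" 0]] sm)
  then have "taylor_coeff f n = c n" for n
    using fps_nth_fps_expansion[of f "Abs_fps c" n] by (simp add: taylor_coeff_def)
  moreover have "f \<in> disc_analytic" using hol by (simp add: disc_analytic_def f_def)
  ultimately show ?thesis by blast
qed


section \<open>Weighted square-summable sequences\<close>

definition wsummable :: "(nat \<Rightarrow> real) \<Rightarrow> (nat \<Rightarrow> complex) \<Rightarrow> bool" where
  "wsummable w c \<longleftrightarrow> summable (\<lambda>n. w n * (cmod (c n))\<^sup>2)"

definition wsum :: "(nat \<Rightarrow> real) \<Rightarrow> (nat \<Rightarrow> complex) \<Rightarrow> (nat \<Rightarrow> complex) \<Rightarrow> complex" where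
  "wsum w c d = (\<Sum>n. of_real (w n) * c n * cnj (d n))"

lemma wsummable_zero: "wsummable w (\<lambda>_. 0)"
  by (simp add: wsummable_def)

lemma wsummable_cmult: "wsummable w c \<Longrightarrow> wsummable w (\<lambda>n. a * c n)"
  unfolding wsummable_def
  by (drule summable_mult[of _ "(cmod a)\<^sup>2"]) (simp add: norm_mult power_mult_distrib mult_ac)

lemma wsummable_add:
  assumes "\<And>n. 0 \<le> w n" "wsummable w c" "wsummable w d"
  shows "wsummable w (\<lambda>n. c n + d n)"
proof -
  have s: "summable (\<lambda>n. 2 * (w n * (cmod (c n))\<^sup>2) + 2 * (w n * (cmod (d n))\<^sup>2))"
    using assms(2,3) unfolding wsummable_def by (intro summable_add summable_mult)
  have b: "w n * (cmod (c n + d n))\<^sup>2 \<le> 2 * (w n * (cmod (c n))\<^sup>2) + 2 * (w n * (cmod (d n))\<^sup>2)" for n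
  proof -
    have "(cmod (c n + d n))\<^sup>2 \<le> (cmod (c n) + cmod (d n))\<^sup>2"
      by (intro power_mono norm_triangle_ineq) simp
    also have "\<dots> \<le> 2 * (cmod (c n))\<^sup>2 + 2 * (cmod (d n))\<^sup>2"
      using sum_squares_bound[of "cmod (c n)" "cmod (d n)"] by (simp add: power2_sum)
    finally have "w n * (cmod (c n + d n))\<^sup>2 \<le> w n * (2 * (cmod (c n))\<^sup>2 + 2 * (cmod (d n))\<^sup>2)"
      by (intro mult_left_mono assms)
    then show ?thesis by (simp add: algebra_simps)
  qed
  show ?thesis unfolding wsummable_def
    by (rule summable_comparison_test'[OF s, of 0]) (use b assms(1) in \<open>simp add: abs_mult\<close>)
qed

lemma wsum_summable:
  assumes "\<And>n. 0 \<le> w n" "wsummable w c" "wsummable w d"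
  shows "summable (\<lambda>n. of_real (w n) * c n * cnj (d n))"
proof -
  have s: "summable (\<lambda>n. w n * (cmod (c n))\<^sup>2 + w n * (cmod (d n))\<^sup>2)"
    using assms(2,3) unfolding wsummable_def by (intro summable_add)
  have b: "w n * cmod (c n) * cmod (d n) \<le> w n * (cmod (c n))\<^sup>2 + w n * (cmod (d n))\<^sup>2" for n
  proof -
    have "cmod (c n) * cmod (d n) \<le> (cmod (c n))\<^sup>2 + (cmod (d n))\<^sup>2"
      using sum_squares_bound[of "cmod (c n)" "cmod (d n)"]
        mult_nonneg_nonneg[OF norm_ge_zero[of "c n"] norm_ge_zero[of "d n"]] by linarith
    then have "w n * (cmod (c n) * cmod (d n)) \<le> w n * ((cmod (c n))\<^sup>2 + (cmod (d n))\<^sup>2)"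
      by (intro mult_left_mono assms)
    then show ?thesis by (simp add: algebra_simps)
  qed
  show ?thesis
    by (rule summable_comparison_test'[OF s, of 0]) (use b assms(1) in \<open>simp add: norm_mult\<close>)
qed

lemma wsum_add:
  assumes "\<And>n. 0 \<le> w n" "wsummable w c" "wsummable w d" "wsummable w e"
  shows "wsum w (\<lambda>n. c n + d n) e = wsum w c e + wsum w d e"
proof -
  have "wsum w c e + wsum w d e =
      (\<Sum>n. of_real (w n) * c n * cnj (e n) + of_real (w n) * d n * cnj (e n))"
    unfolding wsum_def by (intro suminf_add wsum_summable assms)
  then show ?thesis by (simp add: wsum_def algebra_simps)
qed

lemma wsum_cmult:
  assumes "\<And>n. 0 \<le> w n" "wsummable w c" "wsummable w d"
  shows "wsum w (\<lambda>n. a * c n) d = a * wsum w c d"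
proof -
  have "(\<Sum>n. a * (of_real (w n) * c n * cnj (d n))) = a * wsum w c d"
    unfolding wsum_def by (intro suminf_mult wsum_summable assms)
  then show ?thesis by (simp add: wsum_def mult_ac)
qed

lemma wsum_commute:
  assumes "\<And>n. 0 \<le> w n" "wsummable w c" "wsummable w d"
  shows "wsum w d c = cnj (wsum w c d)"
proof -
  have "(\<lambda>n. of_real (w n) * c n * cnj (d n)) sums wsum w c d"
    unfolding wsum_def by (intro summable_sums wsum_summable assms)
  then have "(\<lambda>n. cnj (of_real (w n) * c n * cnj (d n))) sums cnj (wsum w c d)"
    by (simp only: sums_cnj)
  then show ?thesis
    unfolding wsum_def by (intro sums_unique[symmetric]) (simp add: mult_ac)
qed

lemma wsum_self:
  assumes "wsummable w c"
  shows "wsum w c c = of_real (\<Sum>n. w n * (cmod (c n))\<^sup>2)"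
proof -
  have "(\<lambda>n. of_real (w n * (cmod (c n))\<^sup>2)) sums (of_real (\<Sum>n. w n * (cmod (c n))\<^sup>2) :: complex)"
    using assms unfolding wsummable_def by (intro sums_of_real summable_sums)
  moreover have "(of_real (w n * (cmod (c n))\<^sup>2) :: complex) = of_real (w n) * c n * cnj (c n)" for n
    by (simp only: of_real_mult complex_norm_square mult.assoc)
  ultimately have "(\<lambda>n. of_real (w n) * c n * cnj (c n)) sums of_real (\<Sum>n. w n * (cmod (c n))\<^sup>2)"
    by (simp only:)
  then show ?thesis
    unfolding wsum_def by (rule sums_unique[symmetric])
qed

lemma wsum_self_ge_zero:
  assumes "\<And>n. 0 \<le> w n" "wsummable w c"
  shows "0 \<le> Re (wsum w c c)"
  using assms(2) by (simp add: wsum_self) (simp add: suminf_nonneg assms(1) wsummable_def)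

lemma wsum_self_eq_zero:
  assumes "\<And>n. 1 \<le> w n" "wsummable w c" "Re (wsum w c c) = 0"
  shows "c n = 0"
proof -
  have 0: "0 \<le> w m" for m using assms(1)[of m] by linarith
  have "(\<Sum>n. w n * (cmod (c n))\<^sup>2) = 0" using assms(2,3) by (simp add: wsum_self)
  then have "w n * (cmod (c n))\<^sup>2 = 0"
    using assms(2) suminf_eq_zero_iff[of "\<lambda>n. w n * (cmod (c n))\<^sup>2"] 0
    by (auto simp: wsummable_def)
  then show ?thesis using assms(1)[of n] by auto
qed

lemma weighted_term_le:
  assumes "\<And>n. 1 \<le> w n" "wsummable w c" "(\<Sum>n. w n * (cmod (c n))\<^sup>2) \<le> e"
  shows "(cmod (c n))\<^sup>2 \<le> e"
proof -
  have 0: "0 \<le> w m" for m using assms(1)[of m] by linarith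
  have "(cmod (c n))\<^sup>2 \<le> w n * (cmod (c n))\<^sup>2"
    using mult_right_mono[OF assms(1)[of n], of "(cmod (c n))\<^sup>2"] by simp
  also have "\<dots> = (\<Sum>k\<in>{n}. w k * (cmod (c k))\<^sup>2)" by simp
  also have "\<dots> \<le> (\<Sum>n. w n * (cmod (c n))\<^sup>2)"
    using assms(2) 0 by (intro sum_le_suminf) (auto simp: wsummable_def)
  finally show ?thesis using assms(3) by simp
qed

lemma weighted_complete:
  fixes F :: "nat \<Rightarrow> complex \<Rightarrow> complex"
  assumes w: "\<And>n. 1 \<le> w n"
    and F: "\<And>m. F m \<in> disc_analytic" "\<And>m. wsummable w (taylor_coeff (F m))"
    and cau: "\<And>e. e > 0 \<Longrightarrow> \<exists>M. \<forall>m\<ge>M. \<forall>n\<ge>M.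
        (\<Sum>k. w k * (cmod (taylor_coeff (F m) k - taylor_coeff (F n) k))\<^sup>2) < e"
  shows "\<exists>f. f \<in> disc_analytic \<and> wsummable w (taylor_coeff f) \<and> (\<forall>e>0. \<exists>M. \<forall>n\<ge>M.
        (\<Sum>k. w k * (cmod (taylor_coeff (F n) k - taylor_coeff f k))\<^sup>2) \<le> e)"
proof -
  define C where "C m = taylor_coeff (F m)" for m
  have w0: "0 \<le> w n" for n using w[of n] by linarith
  have C: "wsummable w (C m)" for m using F(2) by (simp add: C_def)
  have D: "wsummable w (\<lambda>k. C m k - C n k)" for m n
    using wsummable_add[OF w0 C[of m] wsummable_cmult[OF C[of n], of "-1"]] by simp
  have cau': "\<exists>M. \<forall>m\<ge>M. \<forall>n\<ge>M. (\<Sum>k. w k * (cmod (C m k - C n k))\<^sup>2) < e" if "e > 0" for e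
    using cau[OF that] by (simp add: C_def)
  have "Cauchy (\<lambda>m. C m k)" for k
  proof (rule metric_CauchyI)
    fix e :: real assume e: "e > 0"
    then have "(e/2)\<^sup>2 > 0" by simp
    from cau'[OF this] obtain M where
      M: "\<And>m n. m \<ge> M \<Longrightarrow> n \<ge> M \<Longrightarrow> (\<Sum>k. w k * (cmod (C m k - C n k))\<^sup>2) < (e/2)\<^sup>2" by blast
    have "dist (C m k) (C n k) < e" if "m \<ge> M" "n \<ge> M" for m n
    proof -
      have "(cmod (C m k - C n k))\<^sup>2 \<le> (e/2)\<^sup>2"
        by (rule weighted_term_le[OF w D less_imp_le[OF M[OF that]]])
      then have "cmod (C m k - C n k) \<le> e/2" by (rule power2_le_imp_le) (use e in simp)
      then show ?thesis using e by (simp add: dist_norm)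
    qed
    then show "\<exists>M. \<forall>m\<ge>M. \<forall>n\<ge>M. dist (C m k) (C n k) < e" by blast
  qed
  then have "\<exists>l. (\<lambda>m. C m k) \<longlonglongrightarrow> l" for k
    by (simp add: Cauchy_convergent_iff convergent_def)
  then obtain c where c: "\<And>k. (\<lambda>m. C m k) \<longlonglongrightarrow> c k" by metis
  have key: "\<exists>M. \<forall>n\<ge>M. wsummable w (\<lambda>k. C n k - c k) \<and>
      (\<Sum>k. w k * (cmod (C n k - c k))\<^sup>2) \<le> e" if e: "e > 0" for e
  proof -
    from cau'[OF e] obtain M where
      M: "\<And>m n. m \<ge> M \<Longrightarrow> n \<ge> M \<Longrightarrow> (\<Sum>k. w k * (cmod (C m k - C n k))\<^sup>2) < e" by blast
    have "wsummable w (\<lambda>k. C n k - c k) \<and> (\<Sum>k. w k * (cmod (C n k - c k))\<^sup>2) \<le> e"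
      if n: "n \<ge> M" for n
    proof -
      have part: "(\<Sum>k<K. w k * (cmod (C n k - c k))\<^sup>2) \<le> e" for K
      proof (rule LIMSEQ_le_const2)
        show "(\<lambda>m. \<Sum>k<K. w k * (cmod (C n k - C m k))\<^sup>2) \<longlonglongrightarrow>
            (\<Sum>k<K. w k * (cmod (C n k - c k))\<^sup>2)"
          by (intro tendsto_intros c)
        show "\<exists>N. \<forall>m\<ge>N. (\<Sum>k<K. w k * (cmod (C n k - C m k))\<^sup>2) \<le> e"
        proof (intro exI allI impI)
          fix m assume m: "m \<ge> M"
          have "(\<Sum>k<K. w k * (cmod (C n k - C m k))\<^sup>2) \<le> (\<Sum>k. w k * (cmod (C n k - C m k))\<^sup>2)"
            using D[of n m] w0 by (intro sum_le_suminf) (auto simp: wsummable_def)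
          then show "(\<Sum>k<K. w k * (cmod (C n k - C m k))\<^sup>2) \<le> e" using M[OF n m] by simp
        qed
      qed
      have s: "summable (\<lambda>k. w k * (cmod (C n k - c k))\<^sup>2)"
      proof (rule summableI_nonneg_bounded)
        show "0 \<le> w k * (cmod (C n k - c k))\<^sup>2" for k using w0 by simp
      qed (rule part)
      moreover have "(\<Sum>k. w k * (cmod (C n k - c k))\<^sup>2) \<le> e"
        by (rule suminf_le_const[OF s part])
      ultimately show ?thesis by (simp add: wsummable_def)
    qed
    then show ?thesis by blast
  qed
  from key[of 1] obtain n where n: "wsummable w (\<lambda>k. C n k - c k)" by auto
  have cs: "wsummable w c"
    using wsummable_add[OF w0 C[of n] wsummable_cmult[OF n, of "-1"]] by simp
  have "cmod (c k) \<le> sqrt (\<Sum>k. w k * (cmod (c k))\<^sup>2)" for k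
    using weighted_term_le[OF w cs order_refl] by (intro real_le_rsqrt)
  from taylor_coeff_realize[of c, OF this]
  obtain f where f: "f \<in> disc_analytic" "taylor_coeff f = c" by (auto simp: fun_eq_iff)
  have "\<forall>e>0. \<exists>M. \<forall>n\<ge>M. (\<Sum>k. w k * (cmod (C n k - c k))\<^sup>2) \<le> e"
    using key by blast
  then show ?thesis
    using f cs unfolding C_def by blast
qed


section \<open>The Hardy space \<open>H\<^sup>2\<close> of the disc\<close>

typedef hardy = "{f \<in> disc_analytic. summable (\<lambda>n. (cmod (taylor_coeff f n))\<^sup>2)}"
  by (rule exI[of _ "\<lambda>_. 0"]) (simp add: disc_analytic_zero taylor_coeff_zero)

abbreviation hardy_coeff :: "hardy \<Rightarrow> nat \<Rightarrow> complex" where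
  "hardy_coeff f \<equiv> taylor_coeff (Rep_hardy f)"


lemma hardy_iff: "f \<in> {f \<in> disc_analytic. summable (\<lambda>n. (cmod (taylor_coeff f n))\<^sup>2)} \<longleftrightarrow>
    f \<in> disc_analytic \<and> wsummable (\<lambda>_. 1) (taylor_coeff f)"
  using wsummable_def[of "\<lambda>_. 1"] by simp

lemma Rep_hardy_analytic: "Rep_hardy f \<in> disc_analytic"
  and hardy_wsummable: "wsummable (\<lambda>_. 1) (hardy_coeff f)"
  using Rep_hardy[of f] unfolding hardy_iff by auto

instantiation hardy :: real_vector
begin

definition "0 = Abs_hardy (\<lambda>_. 0)"
definition "f + g = Abs_hardy (\<lambda>z. Rep_hardy f z + Rep_hardy g z)"
definition "- f = Abs_hardy (\<lambda>z. - Rep_hardy f z)"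
definition "f - g = Abs_hardy (\<lambda>z. Rep_hardy f z - Rep_hardy g z)"
definition "r *\<^sub>R f = Abs_hardy (\<lambda>z. of_real r * Rep_hardy f z)"

lemma Rep_hardy_lin:
  "Rep_hardy (Abs_hardy (\<lambda>z. a * Rep_hardy f z + b * Rep_hardy g z)) =
     (\<lambda>z. a * Rep_hardy f z + b * Rep_hardy g z)"
  and hardy_coeff_lin:
  "taylor_coeff (\<lambda>z. a * Rep_hardy f z + b * Rep_hardy g z) n =
     a * hardy_coeff f n + b * hardy_coeff g n"
proof -
  note a = disc_analytic_cmult[OF Rep_hardy_analytic]
  have c: "taylor_coeff (\<lambda>z. a * Rep_hardy f z + b * Rep_hardy g z) n =
     a * hardy_coeff f n + b * hardy_coeff g n" for n
    by (simp add: taylor_coeff_add[OF a a] taylor_coeff_cmult Rep_hardy_analytic)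
  then show "taylor_coeff (\<lambda>z. a * Rep_hardy f z + b * Rep_hardy g z) n =
     a * hardy_coeff f n + b * hardy_coeff g n" .
  have "wsummable (\<lambda>_. 1) (\<lambda>n. a * hardy_coeff f n + b * hardy_coeff g n)"
    by (intro wsummable_add wsummable_cmult hardy_wsummable) auto
  moreover have "taylor_coeff (\<lambda>z. a * Rep_hardy f z + b * Rep_hardy g z) =
      (\<lambda>n. a * hardy_coeff f n + b * hardy_coeff g n)"
    using c by auto
  ultimately show "Rep_hardy (Abs_hardy (\<lambda>z. a * Rep_hardy f z + b * Rep_hardy g z)) =
     (\<lambda>z. a * Rep_hardy f z + b * Rep_hardy g z)"
    by (intro Abs_hardy_inverse) (simp only: hardy_iff disc_analytic_add[OF a a])
qed

lemma Rep_hardy_zero: "Rep_hardy 0 = (\<lambda>_. 0)"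
  using Rep_hardy_lin[of 0 undefined 0 undefined] by (simp add: zero_hardy_def)

lemma Rep_hardy_add: "Rep_hardy (f + g) = (\<lambda>z. Rep_hardy f z + Rep_hardy g z)"
  using Rep_hardy_lin[of 1 f 1 g] by (simp add: plus_hardy_def)

lemma Rep_hardy_minus: "Rep_hardy (- f) = (\<lambda>z. - Rep_hardy f z)"
  using Rep_hardy_lin[of "-1" f 0 f] by (simp add: uminus_hardy_def)

lemma Rep_hardy_diff: "Rep_hardy (f - g) = (\<lambda>z. Rep_hardy f z - Rep_hardy g z)"
  using Rep_hardy_lin[of 1 f "-1" g] by (simp add: minus_hardy_def)

lemma Rep_hardy_scaleR: "Rep_hardy (r *\<^sub>R f) = (\<lambda>z. of_real r * Rep_hardy f z)"
  using Rep_hardy_lin[of "of_real r" f 0 f] by (simp add: scaleR_hardy_def)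

instance
  by standard
     (simp_all add: Rep_hardy_inject[symmetric] Rep_hardy_zero Rep_hardy_add Rep_hardy_minus
        Rep_hardy_diff Rep_hardy_scaleR algebra_simps)

end

instantiation hardy :: real_inner
begin

definition "norm_hardy f = sqrt (\<Sum>n. (cmod (hardy_coeff f n))\<^sup>2)"
definition "inner_hardy f g = Re (\<Sum>n. hardy_coeff f n * cnj (hardy_coeff g n))"
definition "dist_hardy (f :: hardy) g = norm (f - g)"
definition "sgn_hardy (f :: hardy) = f /\<^sub>R norm f"
definition [code del]:
  "(uniformity :: (hardy \<times> hardy) filter) = (INF e\<in>{0 <..}. principal {(x, y). dist x y < e})"
definition [code del]:
  "open_hardy (U :: hardy set) \<longleftrightarrow> (\<forall>x\<in>U. \<forall>\<^sub>F (x', y) in uniformity. x' = x \<longrightarrow> y \<in> U)"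

lemma hardy_cinner_wsum: "(\<Sum>n. hardy_coeff f n * cnj (hardy_coeff g n)) = wsum (\<lambda>_. 1) (hardy_coeff f) (hardy_coeff g)"
  by (simp add: wsum_def)

lemma hardy_norm_wsum: "norm f = sqrt (\<Sum>n. (\<lambda>_. 1) n * (cmod (hardy_coeff f n))\<^sup>2)"
  by (simp add: norm_hardy_def)

lemma hardy_coeff_add: "hardy_coeff (f + g) = (\<lambda>n. hardy_coeff f n + hardy_coeff g n)"
  using hardy_coeff_lin[of 1 f 1 g] by (auto simp: Rep_hardy_add)

lemma hardy_coeff_diff: "hardy_coeff (f - g) = (\<lambda>n. hardy_coeff f n - hardy_coeff g n)"
  using hardy_coeff_lin[of 1 f "-1" g] by (auto simp: Rep_hardy_diff)

lemma hardy_coeff_scaleR: "hardy_coeff (r *\<^sub>R f) = (\<lambda>n. of_real r * hardy_coeff f n)"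
  using hardy_coeff_lin[of "of_real r" f 0 f] by (auto simp: Rep_hardy_scaleR)

instance
proof
  fix x y z :: hardy and r :: real
  show "inner x y = inner y x"
    unfolding inner_hardy_def hardy_cinner_wsum
    by (subst wsum_commute[of "(\<lambda>_. 1)" "hardy_coeff x"]) (simp_all add: hardy_wsummable)
  show "inner (x + y) z = inner x z + inner y z"
    unfolding inner_hardy_def hardy_cinner_wsum unfolding hardy_coeff_add
    by (subst wsum_add) (simp_all add: hardy_wsummable)
  show "inner (r *\<^sub>R x) y = r * inner x y"
    unfolding inner_hardy_def hardy_cinner_wsum unfolding hardy_coeff_scaleR
    by (subst wsum_cmult) (simp_all add: hardy_wsummable)
  show "0 \<le> inner x x"
    unfolding inner_hardy_def hardy_cinner_wsum
    by (rule wsum_self_ge_zero) (simp_all add: hardy_wsummable)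
  show "inner x x = 0 \<longleftrightarrow> x = 0"
  proof
    assume "inner x x = 0"
    then have "hardy_coeff x n = 0" for n
      unfolding inner_hardy_def hardy_cinner_wsum
      by (rule wsum_self_eq_zero[rotated 2]) (simp_all add: hardy_wsummable)
    then have "Rep_hardy x = Rep_hardy 0"
      unfolding Rep_hardy_zero by (intro disc_analytic_eq_zeroI Rep_hardy_analytic)
    then show "x = 0" by (simp add: Rep_hardy_inject)
  next
    assume "x = 0"
    then show "inner x x = 0"
      unfolding inner_hardy_def hardy_cinner_wsum
      by (simp add: Rep_hardy_zero taylor_coeff_zero wsum_def)
  qed
  show "norm x = sqrt (inner x x)"
    unfolding inner_hardy_def hardy_cinner_wsum hardy_norm_wsum
    by (simp add: wsum_self hardy_wsummable)
qed (simp_all add: dist_hardy_def sgn_hardy_def uniformity_hardy_def open_hardy_def)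

end

instantiation hardy :: complex_hilbert
begin

definition "scaleC_hardy a f = Abs_hardy (\<lambda>z. a * Rep_hardy f z)"
definition "cinner_hardy f g = (\<Sum>n. hardy_coeff f n * cnj (hardy_coeff g n))"

lemma Rep_hardy_scaleC: "Rep_hardy (scaleC a f) = (\<lambda>z. a * Rep_hardy f z)"
  using Rep_hardy_lin[of a f 0 f] by (simp add: scaleC_hardy_def)

lemma hardy_coeff_scaleC: "hardy_coeff (scaleC a f) = (\<lambda>n. a * hardy_coeff f n)"
  using hardy_coeff_lin[of a f 0 f] by (auto simp: Rep_hardy_scaleC)

lemma hardy_dist_wsum:
  "dist f g = sqrt (\<Sum>n. (\<lambda>_. 1) n * (cmod (hardy_coeff f n - hardy_coeff g n))\<^sup>2)"
  by (simp only: dist_norm hardy_norm_wsum hardy_coeff_diff)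

instance
proof
  fix x y z :: hardy and a b :: complex and r :: real
  show "scaleC a (x + y) = scaleC a x + scaleC a y"
    "scaleC (a + b) x = scaleC a x + scaleC b x"
    "scaleC a (scaleC b x) = scaleC (a * b) x"
    "scaleC 1 x = x"
    "r *\<^sub>R x = scaleC (complex_of_real r) x"
    by (simp_all add: Rep_hardy_inject[symmetric] Rep_hardy_scaleC Rep_hardy_add Rep_hardy_scaleR
          algebra_simps)
  show "cinner (x + y) z = cinner x z + cinner y z"
    unfolding cinner_hardy_def hardy_cinner_wsum unfolding hardy_coeff_add
    by (subst wsum_add) (simp_all add: hardy_wsummable)
  show "cinner (scaleC a x) y = a * cinner x y"
    unfolding cinner_hardy_def hardy_cinner_wsum unfolding hardy_coeff_scaleC
    by (subst wsum_cmult) (simp_all add: hardy_wsummable)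
  show "cinner y x = cnj (cinner x y)"
    unfolding cinner_hardy_def hardy_cinner_wsum
    by (rule wsum_commute) (simp_all add: hardy_wsummable)
  show "inner x y = Re (cinner x y)"
    by (simp add: inner_hardy_def cinner_hardy_def)
next
  fix X :: "nat \<Rightarrow> hardy"
  assume X: "Cauchy X"
  have cau: "\<exists>M. \<forall>m\<ge>M. \<forall>n\<ge>M.
      (\<Sum>k. (\<lambda>_. 1) k * (cmod (hardy_coeff (X m) k - hardy_coeff (X n) k))\<^sup>2) < e"
    if "e > 0" for e
  proof -
    have "sqrt e > 0" using that by simp
    from metric_CauchyD[OF X this] show ?thesis
      unfolding hardy_dist_wsum real_sqrt_less_iff .
  qed
  have w: "(1::real) \<le> (\<lambda>_. 1) n" for n by simp
  from weighted_complete[of "(\<lambda>_. 1)" "\<lambda>n. Rep_hardy (X n)",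
      OF w Rep_hardy_analytic hardy_wsummable cau]
  obtain f where f: "f \<in> disc_analytic" "wsummable (\<lambda>_. 1) (taylor_coeff f)"
    "\<forall>e>0. \<exists>M. \<forall>n\<ge>M.
        (\<Sum>k. (\<lambda>_. 1) k * (cmod (hardy_coeff (X n) k - taylor_coeff f k))\<^sup>2) \<le> e"
    by blast
  have R: "Rep_hardy (Abs_hardy f) = f"
    using f(1,2) by (intro Abs_hardy_inverse) (simp only: hardy_iff)
  have "X \<longlonglongrightarrow> Abs_hardy f"
  proof (rule metric_LIMSEQ_I)
    fix e :: real assume e: "e > 0"
    then have "(e/2)\<^sup>2 > 0" by simp
    from f(3)[rule_format, OF this] obtain M where M: "\<And>n. n \<ge> M \<Longrightarrow>
        (\<Sum>k. (\<lambda>_. 1) k * (cmod (hardy_coeff (X n) k - taylor_coeff f k))\<^sup>2) \<le> (e/2)\<^sup>2" by blast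
    have "dist (X n) (Abs_hardy f) < e" if "n \<ge> M" for n
    proof -
      have "dist (X n) (Abs_hardy f) \<le> sqrt ((e/2)\<^sup>2)"
        unfolding hardy_dist_wsum R by (intro real_sqrt_le_mono M that)
      also have "\<dots> < e" using e by simp
      finally show ?thesis .
    qed
    then show "\<exists>M. \<forall>n\<ge>M. dist (X n) (Abs_hardy f) < e" by blast
  qed
  then show "convergent X" by (auto simp: convergent_def)
qed

end

section \<open>The Dirichlet space\<close>

typedef dirichlet = "{f \<in> disc_analytic. summable (\<lambda>n. real n * (cmod (taylor_coeff f n))\<^sup>2)}"
  by (rule exI[of _ "\<lambda>_. 0"]) (simp add: disc_analytic_zero taylor_coeff_zero)

abbreviation dirichlet_coeff :: "dirichlet \<Rightarrow> nat \<Rightarrow> complex" where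
  "dirichlet_coeff f \<equiv> taylor_coeff (Rep_dirichlet f)"

abbreviation dirichlet_weight :: "nat \<Rightarrow> real" where
  "dirichlet_weight n \<equiv> (if n = 0 then 1 else real n)"

lemma dirichlet_wsummable_iff:
  "wsummable dirichlet_weight c \<longleftrightarrow> summable (\<lambda>n. real n * (cmod (c n))\<^sup>2)"
proof -
  have "wsummable dirichlet_weight c \<longleftrightarrow>
      summable (\<lambda>n. dirichlet_weight (Suc n) * (cmod (c (Suc n)))\<^sup>2)"
    unfolding wsummable_def by (rule summable_Suc_iff[symmetric])
  also have "\<dots> \<longleftrightarrow> summable (\<lambda>n. real (Suc n) * (cmod (c (Suc n)))\<^sup>2)" by simp
  also have "\<dots> \<longleftrightarrow> summable (\<lambda>n. real n * (cmod (c n))\<^sup>2)"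
    by (rule summable_Suc_iff)
  finally show ?thesis .
qed

lemma dirichlet_iff: "f \<in> {f \<in> disc_analytic. summable (\<lambda>n. real n * (cmod (taylor_coeff f n))\<^sup>2)} \<longleftrightarrow>
    f \<in> disc_analytic \<and> wsummable dirichlet_weight (taylor_coeff f)"
  using dirichlet_wsummable_iff by simp

lemma Rep_dirichlet_analytic: "Rep_dirichlet f \<in> disc_analytic"
  and dirichlet_wsummable: "wsummable dirichlet_weight (dirichlet_coeff f)"
  using Rep_dirichlet[of f] unfolding dirichlet_iff by auto

instantiation dirichlet :: real_vector
begin

definition "0 = Abs_dirichlet (\<lambda>_. 0)"
definition "f + g = Abs_dirichlet (\<lambda>z. Rep_dirichlet f z + Rep_dirichlet g z)"
definition "- f = Abs_dirichlet (\<lambda>z. - Rep_dirichlet f z)"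
definition "f - g = Abs_dirichlet (\<lambda>z. Rep_dirichlet f z - Rep_dirichlet g z)"
definition "r *\<^sub>R f = Abs_dirichlet (\<lambda>z. of_real r * Rep_dirichlet f z)"

lemma Rep_dirichlet_lin:
  "Rep_dirichlet (Abs_dirichlet (\<lambda>z. a * Rep_dirichlet f z + b * Rep_dirichlet g z)) =
     (\<lambda>z. a * Rep_dirichlet f z + b * Rep_dirichlet g z)"
  and dirichlet_coeff_lin:
  "taylor_coeff (\<lambda>z. a * Rep_dirichlet f z + b * Rep_dirichlet g z) n =
     a * dirichlet_coeff f n + b * dirichlet_coeff g n"
proof -
  note a = disc_analytic_cmult[OF Rep_dirichlet_analytic]
  have c: "taylor_coeff (\<lambda>z. a * Rep_dirichlet f z + b * Rep_dirichlet g z) n =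
     a * dirichlet_coeff f n + b * dirichlet_coeff g n" for n
    by (simp add: taylor_coeff_add[OF a a] taylor_coeff_cmult Rep_dirichlet_analytic)
  then show "taylor_coeff (\<lambda>z. a * Rep_dirichlet f z + b * Rep_dirichlet g z) n =
     a * dirichlet_coeff f n + b * dirichlet_coeff g n" .
  have "wsummable dirichlet_weight (\<lambda>n. a * dirichlet_coeff f n + b * dirichlet_coeff g n)"
    by (intro wsummable_add wsummable_cmult dirichlet_wsummable) auto
  moreover have "taylor_coeff (\<lambda>z. a * Rep_dirichlet f z + b * Rep_dirichlet g z) =
      (\<lambda>n. a * dirichlet_coeff f n + b * dirichlet_coeff g n)"
    using c by auto
  ultimately show "Rep_dirichlet (Abs_dirichlet (\<lambda>z. a * Rep_dirichlet f z + b * Rep_dirichlet g z)) =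
     (\<lambda>z. a * Rep_dirichlet f z + b * Rep_dirichlet g z)"
    by (intro Abs_dirichlet_inverse) (simp only: dirichlet_iff disc_analytic_add[OF a a])
qed

lemma Rep_dirichlet_zero: "Rep_dirichlet 0 = (\<lambda>_. 0)"
  using Rep_dirichlet_lin[of 0 undefined 0 undefined] by (simp add: zero_dirichlet_def)

lemma Rep_dirichlet_add: "Rep_dirichlet (f + g) = (\<lambda>z. Rep_dirichlet f z + Rep_dirichlet g z)"
  using Rep_dirichlet_lin[of 1 f 1 g] by (simp add: plus_dirichlet_def)

lemma Rep_dirichlet_minus: "Rep_dirichlet (- f) = (\<lambda>z. - Rep_dirichlet f z)"
  using Rep_dirichlet_lin[of "-1" f 0 f] by (simp add: uminus_dirichlet_def)

lemma Rep_dirichlet_diff: "Rep_dirichlet (f - g) = (\<lambda>z. Rep_dirichlet f z - Rep_dirichlet g z)"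
  using Rep_dirichlet_lin[of 1 f "-1" g] by (simp add: minus_dirichlet_def)

lemma Rep_dirichlet_scaleR: "Rep_dirichlet (r *\<^sub>R f) = (\<lambda>z. of_real r * Rep_dirichlet f z)"
  using Rep_dirichlet_lin[of "of_real r" f 0 f] by (simp add: scaleR_dirichlet_def)

instance
  by standard
     (simp_all add: Rep_dirichlet_inject[symmetric] Rep_dirichlet_zero Rep_dirichlet_add Rep_dirichlet_minus
        Rep_dirichlet_diff Rep_dirichlet_scaleR algebra_simps)

end

text \<open>The term for \<open>n = 0\<close> of the series below vanishes.\<close>

instantiation dirichlet :: real_inner
begin

definition "norm_dirichlet f = sqrt ((cmod (dirichlet_coeff f 0))\<^sup>2 + (\<Sum>n. real n * (cmod (dirichlet_coeff f n))\<^sup>2))"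
definition "inner_dirichlet f g = Re (dirichlet_coeff f 0 * cnj (dirichlet_coeff g 0) + (\<Sum>n. of_nat n * dirichlet_coeff f n * cnj (dirichlet_coeff g n)))"
definition "dist_dirichlet (f :: dirichlet) g = norm (f - g)"
definition "sgn_dirichlet (f :: dirichlet) = f /\<^sub>R norm f"
definition [code del]:
  "(uniformity :: (dirichlet \<times> dirichlet) filter) = (INF e\<in>{0 <..}. principal {(x, y). dist x y < e})"
definition [code del]:
  "open_dirichlet (U :: dirichlet set) \<longleftrightarrow> (\<forall>x\<in>U. \<forall>\<^sub>F (x', y) in uniformity. x' = x \<longrightarrow> y \<in> U)"

lemma dirichlet_cinner_wsum: "(dirichlet_coeff f 0 * cnj (dirichlet_coeff g 0) + (\<Sum>n. of_nat n * dirichlet_coeff f n * cnj (dirichlet_coeff g n))) = wsum dirichlet_weight (dirichlet_coeff f) (dirichlet_coeff g)"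
proof -
  have w: "summable (\<lambda>n. of_real (dirichlet_weight n) * dirichlet_coeff f n * cnj (dirichlet_coeff g n))"
    by (rule wsum_summable) (simp_all add: dirichlet_wsummable)
  have "summable (\<lambda>n. of_real (dirichlet_weight (Suc n)) * dirichlet_coeff f (Suc n) * cnj (dirichlet_coeff g (Suc n)))"
    using w
      summable_Suc_iff[of "\<lambda>n. of_real (dirichlet_weight n) * dirichlet_coeff f n * cnj (dirichlet_coeff g n)"]
    by blast
  then have "summable (\<lambda>n. of_nat (Suc n) * dirichlet_coeff f (Suc n) * cnj (dirichlet_coeff g (Suc n)))"
    by simp
  then have r: "summable (\<lambda>n. of_nat n * dirichlet_coeff f n * cnj (dirichlet_coeff g n))"
    using summable_Suc_iff[of "\<lambda>n. of_nat n * dirichlet_coeff f n * cnj (dirichlet_coeff g n)"]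
    by blast
  show ?thesis
    using suminf_split_head[OF w] suminf_split_head[OF r] by (simp add: wsum_def algebra_simps)
qed

lemma dirichlet_norm_wsum: "norm f = sqrt (\<Sum>n. dirichlet_weight n * (cmod (dirichlet_coeff f n))\<^sup>2)"
proof -
  have w: "summable (\<lambda>n. dirichlet_weight n * (cmod (dirichlet_coeff f n))\<^sup>2)"
    using dirichlet_wsummable[of f] by (simp only: wsummable_def)
  have r: "summable (\<lambda>n. real n * (cmod (dirichlet_coeff f n))\<^sup>2)"
    using dirichlet_wsummable[of f] by (simp only: dirichlet_wsummable_iff)
  show ?thesis
    using suminf_split_head[OF w] suminf_split_head[OF r] by (simp add: norm_dirichlet_def)
qed

lemma dirichlet_coeff_add: "dirichlet_coeff (f + g) = (\<lambda>n. dirichlet_coeff f n + dirichlet_coeff g n)"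
  using dirichlet_coeff_lin[of 1 f 1 g] by (auto simp: Rep_dirichlet_add)

lemma dirichlet_coeff_diff: "dirichlet_coeff (f - g) = (\<lambda>n. dirichlet_coeff f n - dirichlet_coeff g n)"
  using dirichlet_coeff_lin[of 1 f "-1" g] by (auto simp: Rep_dirichlet_diff)

lemma dirichlet_coeff_scaleR: "dirichlet_coeff (r *\<^sub>R f) = (\<lambda>n. of_real r * dirichlet_coeff f n)"
  using dirichlet_coeff_lin[of "of_real r" f 0 f] by (auto simp: Rep_dirichlet_scaleR)

instance
proof
  fix x y z :: dirichlet and r :: real
  show "inner x y = inner y x"
    unfolding inner_dirichlet_def dirichlet_cinner_wsum
    by (subst wsum_commute[of "dirichlet_weight" "dirichlet_coeff x"]) (simp_all add: dirichlet_wsummable)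
  show "inner (x + y) z = inner x z + inner y z"
    unfolding inner_dirichlet_def dirichlet_cinner_wsum unfolding dirichlet_coeff_add
    by (subst wsum_add) (simp_all add: dirichlet_wsummable)
  show "inner (r *\<^sub>R x) y = r * inner x y"
    unfolding inner_dirichlet_def dirichlet_cinner_wsum unfolding dirichlet_coeff_scaleR
    by (subst wsum_cmult) (simp_all add: dirichlet_wsummable)
  show "0 \<le> inner x x"
    unfolding inner_dirichlet_def dirichlet_cinner_wsum
    by (rule wsum_self_ge_zero) (simp_all add: dirichlet_wsummable)
  show "inner x x = 0 \<longleftrightarrow> x = 0"
  proof
    assume "inner x x = 0"
    then have "dirichlet_coeff x n = 0" for n
      unfolding inner_dirichlet_def dirichlet_cinner_wsum
      by (rule wsum_self_eq_zero[rotated 2]) (simp_all add: dirichlet_wsummable)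
    then have "Rep_dirichlet x = Rep_dirichlet 0"
      unfolding Rep_dirichlet_zero by (intro disc_analytic_eq_zeroI Rep_dirichlet_analytic)
    then show "x = 0" by (simp add: Rep_dirichlet_inject)
  next
    assume "x = 0"
    then show "inner x x = 0"
      unfolding inner_dirichlet_def dirichlet_cinner_wsum
      by (simp add: Rep_dirichlet_zero taylor_coeff_zero wsum_def)
  qed
  show "norm x = sqrt (inner x x)"
    unfolding inner_dirichlet_def dirichlet_cinner_wsum dirichlet_norm_wsum
    by (simp add: wsum_self dirichlet_wsummable)
qed (simp_all add: dist_dirichlet_def sgn_dirichlet_def uniformity_dirichlet_def open_dirichlet_def)

end

instantiation dirichlet :: complex_hilbert
begin

definition "scaleC_dirichlet a f = Abs_dirichlet (\<lambda>z. a * Rep_dirichlet f z)"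
definition "cinner_dirichlet f g = (dirichlet_coeff f 0 * cnj (dirichlet_coeff g 0) + (\<Sum>n. of_nat n * dirichlet_coeff f n * cnj (dirichlet_coeff g n)))"

lemma Rep_dirichlet_scaleC: "Rep_dirichlet (scaleC a f) = (\<lambda>z. a * Rep_dirichlet f z)"
  using Rep_dirichlet_lin[of a f 0 f] by (simp add: scaleC_dirichlet_def)

lemma dirichlet_coeff_scaleC: "dirichlet_coeff (scaleC a f) = (\<lambda>n. a * dirichlet_coeff f n)"
  using dirichlet_coeff_lin[of a f 0 f] by (auto simp: Rep_dirichlet_scaleC)

lemma dirichlet_dist_wsum:
  "dist f g = sqrt (\<Sum>n. dirichlet_weight n * (cmod (dirichlet_coeff f n - dirichlet_coeff g n))\<^sup>2)"
  by (simp only: dist_norm dirichlet_norm_wsum dirichlet_coeff_diff)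

instance
proof
  fix x y z :: dirichlet and a b :: complex and r :: real
  show "scaleC a (x + y) = scaleC a x + scaleC a y"
    "scaleC (a + b) x = scaleC a x + scaleC b x"
    "scaleC a (scaleC b x) = scaleC (a * b) x"
    "scaleC 1 x = x"
    "r *\<^sub>R x = scaleC (complex_of_real r) x"
    by (simp_all add: Rep_dirichlet_inject[symmetric] Rep_dirichlet_scaleC Rep_dirichlet_add Rep_dirichlet_scaleR
          algebra_simps)
  show "cinner (x + y) z = cinner x z + cinner y z"
    unfolding cinner_dirichlet_def dirichlet_cinner_wsum unfolding dirichlet_coeff_add
    by (subst wsum_add) (simp_all add: dirichlet_wsummable)
  show "cinner (scaleC a x) y = a * cinner x y"
    unfolding cinner_dirichlet_def dirichlet_cinner_wsum unfolding dirichlet_coeff_scaleC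
    by (subst wsum_cmult) (simp_all add: dirichlet_wsummable)
  show "cinner y x = cnj (cinner x y)"
    unfolding cinner_dirichlet_def dirichlet_cinner_wsum
    by (rule wsum_commute) (simp_all add: dirichlet_wsummable)
  show "inner x y = Re (cinner x y)"
    by (simp add: inner_dirichlet_def cinner_dirichlet_def)
next
  fix X :: "nat \<Rightarrow> dirichlet"
  assume X: "Cauchy X"
  have cau: "\<exists>M. \<forall>m\<ge>M. \<forall>n\<ge>M.
      (\<Sum>k. dirichlet_weight k * (cmod (dirichlet_coeff (X m) k - dirichlet_coeff (X n) k))\<^sup>2) < e"
    if "e > 0" for e
  proof -
    have "sqrt e > 0" using that by simp
    from metric_CauchyD[OF X this] show ?thesis
      unfolding dirichlet_dist_wsum real_sqrt_less_iff .
  qed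
  have w: "(1::real) \<le> dirichlet_weight n" for n by simp
  from weighted_complete[of "dirichlet_weight" "\<lambda>n. Rep_dirichlet (X n)",
      OF w Rep_dirichlet_analytic dirichlet_wsummable cau]
  obtain f where f: "f \<in> disc_analytic" "wsummable dirichlet_weight (taylor_coeff f)"
    "\<forall>e>0. \<exists>M. \<forall>n\<ge>M.
        (\<Sum>k. dirichlet_weight k * (cmod (dirichlet_coeff (X n) k - taylor_coeff f k))\<^sup>2) \<le> e"
    by blast
  have R: "Rep_dirichlet (Abs_dirichlet f) = f"
    using f(1,2) by (intro Abs_dirichlet_inverse) (simp only: dirichlet_iff)
  have "X \<longlonglongrightarrow> Abs_dirichlet f"
  proof (rule metric_LIMSEQ_I)
    fix e :: real assume e: "e > 0"
    then have "(e/2)\<^sup>2 > 0" by simp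
    from f(3)[rule_format, OF this] obtain M where M: "\<And>n. n \<ge> M \<Longrightarrow>
        (\<Sum>k. dirichlet_weight k * (cmod (dirichlet_coeff (X n) k - taylor_coeff f k))\<^sup>2) \<le> (e/2)\<^sup>2" by blast
    have "dist (X n) (Abs_dirichlet f) < e" if "n \<ge> M" for n
    proof -
      have "dist (X n) (Abs_dirichlet f) \<le> sqrt ((e/2)\<^sup>2)"
        unfolding dirichlet_dist_wsum R by (intro real_sqrt_le_mono M that)
      also have "\<dots> < e" using e by simp
      finally show ?thesis .
    qed
    then show "\<exists>M. \<forall>n\<ge>M. dist (X n) (Abs_dirichlet f) < e" by blast
  qed
  then show "convergent X" by (auto simp: convergent_def)
qed

end

end

theory Submission
  imports Defs
begin

text \<open>
  The equivalence is a Schwarz--Pick argument in the time variable.  Fix \<open>z\<close> in the disc and let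
  \<open>S\<close> be the analytic extension of the semigroup to a sector.  The function
  \<open>\<Phi>\<^sub>z \<xi> = (S \<xi> id) z\<close> is analytic on the open sector, equals \<open>\<phi>\<^sub>t z\<close> at \<open>\<xi> = t > 0\<close>, and satisfies
  \<open>\<bar>\<Phi>\<^sub>z\<bar> \<le> 1\<close>: the identity theorem gives \<open>(\<Phi>\<^sub>z \<xi>)\<^sup>n = (S \<xi> id\<^sup>n) z\<close>, and the norms of \<open>id\<^sup>n\<close> grow too
  slowly for a value outside the closed disc (\<open>semiflow_extension\<close>).  So all \<open>\<Phi>\<^sub>z\<close> map one and the
  same domain to the closed disc.  If they stay uniformly away from the unit circle at one point
  \<open>t\<^sub>0\<close>, they do so at every point of the domain, by Montel's theorem and the maximum principle
  (\<open>uniform_bound_transfer\<close>).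

  For the trace class, let \<open>r = \<parallel>\<phi>\<^sub>t\<parallel>\<^sub>\<infinity> < 1\<close> and let \<open>T\<close> be the composition operator of \<open>\<phi>\<^sub>t\<close>.  Then
  \<open>\<parallel>T z\<^sup>n\<parallel> = \<parallel>\<phi>\<^sub>t\<^sup>n\<parallel>\<close> is at most \<open>r\<^sup>n\<close> in \<open>H\<^sup>2\<close>, and at most \<open>r\<^sup>n + n r\<^bsup>n-1\<^esup> \<parallel>\<phi>\<^sub>t\<parallel>\<close> in the Dirichlet space,
  since \<open>(\<phi>\<^sub>t\<^sup>n)' = n \<phi>\<^sub>t\<^bsup>n-1\<^esup> \<phi>\<^sub>t'\<close> and, by Parseval's identity, a bounded
  factor enlarges square means over circles by at most the square of its bound.  Hence \<open>\<Sum>\<^sub>n \<parallel>T e\<^sub>n\<parallel> < \<infinity>\<close> for the orthonormal basis of normalised monomials,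
  which bounds the trace \<open>\<Sum>\<^sub>n \<langle>\<bar>T\<bar> e\<^sub>n, e\<^sub>n\<rangle>\<close> (\<open>trace_class_if_summable_norm\<close>).  That \<open>\<bar>T\<bar>\<close> exists is part of
  what has to be shown; it comes from a norm convergent iteration for the square root of \<open>T\<^sup>*T\<close>.
\<close>

section \<open>The absolute value of an operator and a criterion for the trace class\<close>

instance complex_hilbert \<subseteq> banach ..

lemma scaleC_zero_left: "scaleC 0 (x :: 'a::complex_hilbert) = 0"
  using norm_scaleC[of 0 x] by simp

lemma scaleC_zero_right: "scaleC a 0 = (0 :: 'a::complex_hilbert)"
  using norm_scaleC[of a "0 :: 'a"] by simp

lemma scaleC_diff_right: "scaleC a (x - y) = scaleC a x - scaleC a (y :: 'a::complex_hilbert)"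
  by (rule linear_diff[OF bounded_linear.linear[OF bounded_linear_scaleC]])

lemma cinner_add_right: "cinner x (y + z) = cinner x y + cinner x (z :: 'a::complex_hilbert)"
  by (metis cinner_add_left cinner_commute complex_cnj_add)

lemma cinner_scaleC_right: "cinner x (scaleC a y) = cnj a * cinner x (y :: 'a::complex_hilbert)"
  by (metis cinner_commute cinner_scaleC_left complex_cnj_mult)

lemma cinner_scaleR_left: "cinner (r *\<^sub>R x) y = of_real r * cinner x (y :: 'a::complex_hilbert)"
  by (simp add: scaleR_scaleC cinner_scaleC_left)

lemma cinner_scaleR_right: "cinner x (r *\<^sub>R y) = of_real r * cinner x (y :: 'a::complex_hilbert)"
  by (simp add: scaleR_scaleC cinner_scaleC_right)

lemma cinner_diff_left: "cinner (x - y) z = cinner x z - cinner y (z :: 'a::complex_hilbert)"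
  using cinner_add_left[of "x - y" y z] by simp

lemma cinner_diff_right: "cinner x (y - z) = cinner x y - cinner x (z :: 'a::complex_hilbert)"
  using cinner_add_right[of x "y - z" z] by simp

lemma cinner_zero_left: "cinner 0 (y :: 'a::complex_hilbert) = 0"
  using cinner_diff_left[of 0 0 y] by simp

lemma cinner_zero_right: "cinner (x :: 'a::complex_hilbert) 0 = 0"
  using cinner_diff_right[of x 0 0] by simp

lemma cinner_self: "cinner x x = of_real ((norm (x :: 'a::complex_hilbert))\<^sup>2)"
proof (rule complex_eqI)
  show "Re (cinner x x) = Re (of_real ((norm x)\<^sup>2))"
    by (simp add: inner_cinner[symmetric] power2_norm_eq_inner)
  have "Im (cinner x x) = - Im (cinner x x)"
    using cinner_commute[of x x] by (metis cnj.simps(2))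
  then show "Im (cinner x x) = Im (of_real ((norm x)\<^sup>2))" by simp
qed

lemma cinner_Cauchy_Schwarz: "cmod (cinner x y) \<le> norm x * norm (y :: 'a::complex_hilbert)"
proof (cases "cinner x y = 0")
  case False
  \<comment> \<open>A unimodular factor turns the inner product into a positive real number.\<close>
  define a where "a = cnj (cinner x y) / of_real (cmod (cinner x y))"
  have a: "cmod a = 1" using False by (simp add: a_def norm_divide)
  have "a * cinner x y = of_real (cmod (cinner x y))"
    using False by (simp add: a_def mult.commute[of "cnj _"] complex_norm_square[symmetric] power2_eq_square)
  then have "cmod (cinner x y) = inner (scaleC a x) y"
    by (simp add: inner_cinner cinner_scaleC_left)
  also have "\<dots> \<le> norm (scaleC a x) * norm y" by (rule norm_cauchy_schwarz)
  finally show ?thesis by (simp add: norm_scaleC a)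
qed simp

lemma bounded_linear_cinner_left: "bounded_linear (\<lambda>x. cinner x (y :: 'a::complex_hilbert))"
  by (rule bounded_linear_intro[of _ "norm y"])
     (auto simp: cinner_add_left cinner_scaleR_left scaleR_conv_of_real cinner_Cauchy_Schwarz)

lemma bounded_linear_cinner_right: "bounded_linear (cinner (x :: 'a::complex_hilbert))"
  by (rule bounded_linear_intro[of _ "norm x"])
     (auto simp: cinner_add_right cinner_scaleR_right scaleR_conv_of_real
       intro: order_trans[OF cinner_Cauchy_Schwarz])

text \<open>
  The iteration whose limit \<open>X\<close> solves \<open>X = (C + X\<^sup>2) / 2\<close>, so that \<open>(I - X)\<^sup>2 = I - C\<close>.  For a
  contraction \<open>C\<close> the increments are dominated by those of the same iteration for the number 1,
  which increases and is bounded by 1; hence it converges in norm.  Every iterate is a polynomial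
  in \<open>C\<close> with real coefficients, so self-adjointness passes to the limit.
\<close>

primrec sqrt_iter :: "('a::banach \<Rightarrow>\<^sub>L 'a) \<Rightarrow> nat \<Rightarrow> 'a \<Rightarrow>\<^sub>L 'a" where
  "sqrt_iter C 0 = 0"
| "sqrt_iter C (Suc n) = (1/2) *\<^sub>R (C + (sqrt_iter C n o\<^sub>L sqrt_iter C n))"

primrec sqrt_iter_bound :: "nat \<Rightarrow> real" where
  "sqrt_iter_bound 0 = 0"
| "sqrt_iter_bound (Suc n) = (1 + (sqrt_iter_bound n)\<^sup>2) / 2"

lemma sqrt_iter_bound_range: "0 \<le> sqrt_iter_bound n \<and> sqrt_iter_bound n \<le> 1"
proof (induction n)
  case (Suc n)
  then have "(sqrt_iter_bound n)\<^sup>2 \<le> 1" by (simp add: power_le_one)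
  then show ?case by simp
qed simp

lemma norm_sqrt_iter_le:
  assumes "norm C \<le> 1"
  shows "norm (sqrt_iter C n) \<le> sqrt_iter_bound n"
proof (induction n)
  case (Suc n)
  have "norm (sqrt_iter C n o\<^sub>L sqrt_iter C n) \<le> norm (sqrt_iter C n) * norm (sqrt_iter C n)"
    by (rule norm_blinfun_compose)
  also have "\<dots> \<le> (sqrt_iter_bound n)\<^sup>2"
    unfolding power2_eq_square by (intro mult_mono Suc) (auto simp: sqrt_iter_bound_range)
  finally show ?case
    using norm_triangle_ineq[of C "sqrt_iter C n o\<^sub>L sqrt_iter C n"] assms by simp
qed simp

text \<open>
  Since \<open>X\<^sup>2 - Y\<^sup>2 = (X - Y) X + Y (X - Y)\<close>, the norms of the increments satisfy as an inequality
  the recursion that holds with equality for the scalar iteration.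
\<close>

lemma norm_sqrt_iter_diff_le:
  assumes C: "norm C \<le> 1"
  shows "norm (sqrt_iter C (Suc n) - sqrt_iter C n) \<le> sqrt_iter_bound (Suc n) - sqrt_iter_bound n"
proof (induction n)
  case 0
  then show ?case using C by (simp add: bounded_bilinear.zero_left[OF bounded_bilinear_blinfun_compose])
next
  case (Suc n)
  define X Y where "X = sqrt_iter C (Suc n)" and "Y = sqrt_iter C n"
  define x y where "x = sqrt_iter_bound (Suc n)" and "y = sqrt_iter_bound n"
  have XY: "norm (X - Y) \<le> x - y" using Suc by (simp only: X_def Y_def x_def y_def)
  have X: "norm X \<le> x" unfolding X_def x_def by (rule norm_sqrt_iter_le[OF C])
  have Y: "norm Y \<le> y" unfolding Y_def y_def by (rule norm_sqrt_iter_le[OF C])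
  have xy: "0 \<le> x - y" using order_trans[OF norm_ge_zero XY] .
  have y0: "0 \<le> y" using order_trans[OF norm_ge_zero Y] .
  have "sqrt_iter C (Suc (Suc n)) - X = (1/2) *\<^sub>R (C + (X o\<^sub>L X)) - (1/2) *\<^sub>R (C + (Y o\<^sub>L Y))"
    by (simp add: X_def Y_def)
  also have "\<dots> = (1/2) *\<^sub>R (((X - Y) o\<^sub>L X) + (Y o\<^sub>L (X - Y)))"
    by (rule blinfun_eqI)
       (simp add: blinfun.add_left blinfun.diff_left blinfun.diff_right blinfun.scaleR_left
         scaleR_diff_right scaleR_add_right)
  also have "norm \<dots> \<le> (norm (X - Y) * norm X + norm Y * norm (X - Y)) / 2"
    using norm_triangle_ineq[of "(X - Y) o\<^sub>L X" "Y o\<^sub>L (X - Y)"]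
      norm_blinfun_compose[of "X - Y" X] norm_blinfun_compose[of Y "X - Y"] by simp
  also have "\<dots> \<le> ((x - y) * x + y * (x - y)) / 2"
  proof -
    have "norm (X - Y) * norm X \<le> (x - y) * x"
      by (intro mult_mono XY X xy norm_ge_zero)
    moreover have "norm Y * norm (X - Y) \<le> y * (x - y)"
      by (intro mult_mono XY Y y0 norm_ge_zero)
    ultimately show ?thesis by simp
  qed
  also have "\<dots> = sqrt_iter_bound (Suc (Suc n)) - x"
    by (simp add: x_def y_def power2_eq_square field_simps)
  finally show ?case by (simp only: X_def x_def)
qed

lemma sqrt_iter_limit:
  assumes C: "norm C \<le> 1"
  obtains X where "sqrt_iter C \<longlonglongrightarrow> X" "norm X \<le> 1" "X = (1/2) *\<^sub>R (C + (X o\<^sub>L X))"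
proof -
  have "summable (\<lambda>n. sqrt_iter_bound (Suc n) - sqrt_iter_bound n)"
  proof (rule summableI_nonneg_bounded)
    show "0 \<le> sqrt_iter_bound (Suc n) - sqrt_iter_bound n" for n
      using order_trans[OF norm_ge_zero norm_sqrt_iter_diff_le[OF C]] .
    show "(\<Sum>k<n. sqrt_iter_bound (Suc k) - sqrt_iter_bound k) \<le> 1" for n
      using sqrt_iter_bound_range[of n] by (simp only: sum_lessThan_telescope) simp
  qed
  then have "summable (\<lambda>n. sqrt_iter C (Suc n) - sqrt_iter C n)"
    by (rule summable_comparison_test'[where N = 0]) (rule norm_sqrt_iter_diff_le[OF C])
  then have "(\<lambda>n. \<Sum>k<n. sqrt_iter C (Suc k) - sqrt_iter C k)
      \<longlonglongrightarrow> (\<Sum>k. sqrt_iter C (Suc k) - sqrt_iter C k)"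
    by (rule summable_LIMSEQ)
  then obtain X where X: "sqrt_iter C \<longlonglongrightarrow> X"
    by (auto simp only: sum_lessThan_telescope sqrt_iter.simps(1) diff_zero)
  have "norm X \<le> 1"
  proof (rule LIMSEQ_le_const2[OF tendsto_norm[OF X]])
    show "\<exists>N. \<forall>n\<ge>N. norm (sqrt_iter C n) \<le> 1"
      using norm_sqrt_iter_le[OF C] sqrt_iter_bound_range by (meson order_trans)
  qed
  moreover have "(\<lambda>n. sqrt_iter C (Suc n)) \<longlonglongrightarrow> (1/2) *\<^sub>R (C + (X o\<^sub>L X))"
    unfolding sqrt_iter.simps
    by (intro tendsto_intros X bounded_bilinear.tendsto[OF bounded_bilinear_blinfun_compose])
  then have "X = (1/2) *\<^sub>R (C + (X o\<^sub>L X))"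
    using LIMSEQ_Suc[OF X] LIMSEQ_unique by blast
  ultimately show thesis using X that by blast
qed

lemma sqrt_iter_closed:
  assumes "sqrt_iter C \<longlonglongrightarrow> X" and "closed P" and "0 \<in> P"
    and "\<And>Y. Y \<in> P \<Longrightarrow> (1/2) *\<^sub>R (C + (Y o\<^sub>L Y)) \<in> P"
  shows "X \<in> P"
proof -
  have "sqrt_iter C n \<in> P" for n using assms(3,4) by (induction n) auto
  then show ?thesis using assms(1,2) by (meson closed_sequentially)
qed

definition clinear_selfadjoint :: "('a::complex_hilbert \<Rightarrow>\<^sub>L 'a) set" where
  "clinear_selfadjoint = {X. (\<forall>a x. blinfun_apply X (scaleC a x) = scaleC a (blinfun_apply X x)) \<and>
     (\<forall>x y. cinner (blinfun_apply X x) y = cinner x (blinfun_apply X y))}"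

lemma closed_clinear_selfadjoint: "closed clinear_selfadjoint"
proof -
  have eq: "clinear_selfadjoint =
    (\<Inter>a x. {X. blinfun_apply X (scaleC a x) = scaleC a (blinfun_apply X x)}) \<inter>
    (\<Inter>x y. {X. cinner (blinfun_apply X x) y = cinner x (blinfun_apply X y)})"
    by (auto simp: clinear_selfadjoint_def)
  have app: "continuous_on UNIV (\<lambda>X. blinfun_apply X x)" for x :: 'a
    by (intro continuous_intros)
  have 1: "continuous_on UNIV (\<lambda>X. scaleC a (blinfun_apply X x))" for a and x :: 'a
    by (rule bounded_linear.continuous_on[OF bounded_linear_scaleC app])
  have 2: "continuous_on UNIV (\<lambda>X. cinner (blinfun_apply X x) y)" for x y :: 'a
    by (rule bounded_linear.continuous_on[OF bounded_linear_cinner_left app])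
  have 3: "continuous_on UNIV (\<lambda>X. cinner x (blinfun_apply X y))" for x y :: 'a
    by (rule bounded_linear.continuous_on[OF bounded_linear_cinner_right app])
  show ?thesis unfolding eq
    by (intro closed_Int closed_INT ballI closed_Collect_eq app 1 2 3)
qed

text \<open>
  After scaling \<open>T\<close> to a contraction, \<open>I - T\<^sup>* T\<close> is a contraction as well, because
  \<open>\<parallel>T\<^sup>* T x\<parallel>\<^sup>2 \<le> \<parallel>T x\<parallel>\<^sup>2 = \<langle>T\<^sup>* T x, x\<rangle>\<close>; the limit \<open>X\<close> of its iteration gives \<open>\<bar>T\<bar> = I - X\<close>.
\<close>

lemma absolute_value_exists:
  fixes T :: "'a::complex_hilbert \<Rightarrow> 'a"
  assumes T: "bounded_operator T" and S: "adjoint_operator T S"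
  shows "\<exists>A. absolute_value T A"
proof -
  have blT: "bounded_linear T" and cT: "\<And>a x. T (scaleC a x) = scaleC a (T x)"
    using T by (auto simp: bounded_operator_def)
  have blS: "bounded_linear S" and cS: "\<And>a x. S (scaleC a x) = scaleC a (S x)"
    and adj: "\<And>x y. cinner (T x) y = cinner x (S y)"
    using S by (auto simp: adjoint_operator_def bounded_operator_def)
  have adj': "cinner (S x) y = cinner x (T y)" for x y
    by (metis adj cinner_commute)
  obtain k where k: "k > 0" "\<And>x. norm (T x) \<le> norm x * k"
    using bounded_linear.pos_bounded[OF blT] by blast
  have normS: "norm (S y) \<le> k * norm y" for y
  proof -
    have "(norm (S y))\<^sup>2 = cmod (cinner (T (S y)) y)"
      by (simp add: adj cinner_self norm_power)
    also have "\<dots> \<le> norm (T (S y)) * norm y" by (rule cinner_Cauchy_Schwarz)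
    also have "\<dots> \<le> norm (S y) * k * norm y" by (intro mult_right_mono k) simp
    finally have "norm (S y) * norm (S y) \<le> norm (S y) * (k * norm y)"
      by (simp add: power2_eq_square mult_ac)
    then show ?thesis using k(1) by (cases "norm (S y) = 0") (auto simp: mult_le_cancel_left)
  qed
  define B where "B x = (1 / k\<^sup>2) *\<^sub>R S (T x)" for x
  have blB: "bounded_linear B" unfolding B_def
    by (intro bounded_linear_intros bounded_linear_compose[OF blS blT])
  then have blC: "bounded_linear (\<lambda>x. x - B x)"
    by (intro bounded_linear_sub bounded_linear_ident)
  define C where "C = Blinfun (\<lambda>x. x - B x)"
  have C: "blinfun_apply C x = x - B x" for x
    unfolding C_def by (simp add: bounded_linear_Blinfun_apply[OF blC])
  have Bin: "cinner (B x) y = of_real (1 / k\<^sup>2) * cinner (T x) (T y)" for x y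
    by (simp only: B_def cinner_scaleR_left adj')
  have Bin': "cinner x (B y) = of_real (1 / k\<^sup>2) * cinner (T x) (T y)" for x y
    by (simp only: B_def cinner_scaleR_right adj)
  have "norm C \<le> 1"
  proof (rule norm_blinfun_bound)
    fix x
    have "(norm (C x))\<^sup>2 = (norm x)\<^sup>2 - 2 * inner (B x) x + (norm (B x))\<^sup>2"
      by (simp add: C power2_norm_eq_inner inner_diff inner_commute)
    moreover have iB: "inner (B x) x = (norm (T x))\<^sup>2 / k\<^sup>2"
      by (simp add: inner_cinner Bin cinner_self)
    moreover have "(norm (B x))\<^sup>2 \<le> (norm (T x))\<^sup>2 / k\<^sup>2"
    proof -
      have "norm (B x) = norm (S (T x)) / k\<^sup>2" using k(1) by (simp add: B_def)
      also have "\<dots> \<le> k * norm (T x) / k\<^sup>2" by (intro divide_right_mono normS) simp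
      also have "\<dots> = norm (T x) / k" using k(1) by (simp add: power2_eq_square)
      finally have "(norm (B x))\<^sup>2 \<le> (norm (T x) / k)\<^sup>2" by (intro power_mono) simp_all
      then show ?thesis by (simp add: power_divide)
    qed
    moreover have "0 \<le> (norm (T x))\<^sup>2 / k\<^sup>2" by simp
    ultimately have "(norm (C x))\<^sup>2 \<le> (norm x)\<^sup>2" by linarith
    then show "norm (C x) \<le> 1 * norm x" by (simp add: power2_le_iff_abs_le)
  qed simp
  then obtain X where lim: "sqrt_iter C \<longlonglongrightarrow> X" and X1: "norm X \<le> 1"
    and fixX: "X = (1/2) *\<^sub>R (C + (X o\<^sub>L X))"
    by (rule sqrt_iter_limit)
  have "X \<in> clinear_selfadjoint"
  proof (rule sqrt_iter_closed[OF lim closed_clinear_selfadjoint])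
    show "0 \<in> clinear_selfadjoint"
      by (simp add: clinear_selfadjoint_def scaleC_zero_right cinner_zero_left cinner_zero_right)
  next
    fix Y :: "'a \<Rightarrow>\<^sub>L 'a" assume Y: "Y \<in> clinear_selfadjoint"
    have 1: "C (scaleC a x) = scaleC a (C x)" for a x
      by (simp add: C B_def cT cS scaleC_diff_right scaleR_scaleC scaleC_scaleC mult.commute)
    have 2: "cinner (C x) y = cinner x (C y)" for x y
      by (simp add: C cinner_diff_left cinner_diff_right Bin Bin')
    show "(1/2) *\<^sub>R (C + (Y o\<^sub>L Y)) \<in> clinear_selfadjoint"
      using Y unfolding clinear_selfadjoint_def
      by (simp add: 1 2 blinfun.add_left blinfun.scaleR_left scaleR_scaleC scaleC_add_right
          scaleC_scaleC mult.commute cinner_add_left cinner_add_right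
          cinner_scaleC_left cinner_scaleC_right)
  qed
  then have cX: "X (scaleC a x) = scaleC a (X x)" and Xadj: "cinner (X x) y = cinner x (X y)" for a x y
    by (auto simp: clinear_selfadjoint_def)
  define A where "A x = k *\<^sub>R (x - X x)" for x
  have "bounded_linear A" unfolding A_def
    by (intro bounded_linear_intros bounded_linear_sub blinfun.bounded_linear_right)
  moreover have "A (scaleC a x) = scaleC a (A x)" for a x
    by (simp add: A_def cX scaleR_scaleC scaleC_scaleC mult.commute scaleC_diff_right)
  ultimately have bA: "bounded_operator A" by (simp add: bounded_operator_def)
  have "Im (cinner (A x) x) = 0 \<and> 0 \<le> Re (cinner (A x) x)" for x
  proof -
    have "Im (cinner (X x) x) = - Im (cinner (X x) x)"
      by (metis Xadj cinner_commute cnj.simps(2))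
    then have "Im (cinner (X x) x) = 0" by simp
    moreover have "Re (cinner (X x) x) \<le> (norm x)\<^sup>2"
    proof -
      have "Re (cinner (X x) x) \<le> cmod (cinner (X x) x)" by (rule complex_Re_le_cmod)
      also have "\<dots> \<le> norm (X x) * norm x" by (rule cinner_Cauchy_Schwarz)
      also have "\<dots> \<le> (1 * norm x) * norm x"
        by (intro mult_right_mono order_trans[OF norm_blinfun] X1) auto
      finally show ?thesis by (simp add: power2_eq_square)
    qed
    ultimately show ?thesis
      using k(1) by (simp add: A_def cinner_scaleR_left cinner_diff_left cinner_self)
  qed
  then have "positive_operator A" using bA by (simp add: positive_operator_def)
  moreover have "A \<circ> A = S \<circ> T"
  proof
    fix x
    have "2 *\<^sub>R X = 2 *\<^sub>R ((1/2) *\<^sub>R (C + (X o\<^sub>L X)))"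
      using fixX by (rule arg_cong)
    then have "2 *\<^sub>R X = C + (X o\<^sub>L X)" by (simp only: scaleR_scaleR) simp
    from arg_cong[OF this, of "\<lambda>Y. blinfun_apply Y x"]
    have "2 *\<^sub>R X x = C x + X (X x)" by (simp add: blinfun.add_left blinfun.scaleR_left)
    then have XX: "X (X x) = 2 *\<^sub>R X x - x + B x" by (simp add: C)
    have "A (A x) = k\<^sup>2 *\<^sub>R (x - 2 *\<^sub>R X x + X (X x))"
      by (simp add: A_def blinfun.diff_right blinfun.scaleR_right power2_eq_square
          scaleR_diff_right scaleR_add_right mult_2 scaleR_2)
    also have "\<dots> = k\<^sup>2 *\<^sub>R B x" by (simp add: XX)
    also have "\<dots> = S (T x)" using k(1) by (simp add: B_def)
    finally show "(A \<circ> A) x = (S \<circ> T) x" by simp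
  qed
  ultimately show ?thesis using S by (auto simp: absolute_value_def)
qed

text \<open>
  Summability of \<open>\<parallel>T e\<^sub>n\<parallel>\<close> gives the adjoint as the absolutely convergent series
  \<open>y \<mapsto> \<Sum>n. \<langle>y, T e\<^sub>n\<rangle> e\<^sub>n\<close>, whose terms are bounded by \<open>\<parallel>y\<parallel> \<parallel>T e\<^sub>n\<parallel>\<close>.
\<close>

lemma adjoint_exists_if_summable_norm:
  fixes T :: "'a::complex_hilbert \<Rightarrow> 'a" and e :: "nat \<Rightarrow> 'a"
  assumes T: "bounded_operator T"
    and unit: "\<And>n. norm (e n) = 1"
    and expand: "\<And>x. (\<lambda>n. scaleC (cinner x (e n)) (e n)) sums x"
    and summ: "summable (\<lambda>n. norm (T (e n)))"
  shows "\<exists>S. adjoint_operator T S"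
proof -
  have blT: "bounded_linear T" and cT: "\<And>a x. T (scaleC a x) = scaleC a (T x)"
    using T by (auto simp: bounded_operator_def)
  define S where "S y = (\<Sum>n. scaleC (cinner y (T (e n))) (e n))" for y
  have bound: "norm (scaleC (cinner y (T (e n))) (e n)) \<le> norm y * norm (T (e n))" for y n
    by (simp add: norm_scaleC unit cinner_Cauchy_Schwarz)
  have absS: "summable (\<lambda>n. norm (scaleC (cinner y (T (e n))) (e n)))" for y
    by (rule summable_comparison_test'[OF summable_mult[OF summ, of "norm y"], of 0])
       (simp add: bound)
  have sumS: "(\<lambda>n. scaleC (cinner y (T (e n))) (e n)) sums S y" for y
    unfolding S_def using summable_sums[OF summable_norm_cancel[OF absS]] .
  have Sadd: "S (x + y) = S x + S y" for x y
    using sums_unique2[OF sumS[of "x + y"]] sums_add[OF sumS[of x] sumS[of y]]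
    by (simp add: cinner_add_left scaleC_add_left)
  have SscaleC: "S (scaleC a x) = scaleC a (S x)" for a x
    using sums_unique2[OF sumS[of "scaleC a x"]]
      bounded_linear.sums[OF bounded_linear_scaleC sumS[of x], of a]
    by (simp add: cinner_scaleC_left scaleC_scaleC)
  have "norm (S y) \<le> norm y * (\<Sum>n. norm (T (e n)))" for y
  proof -
    have "norm (S y) \<le> (\<Sum>n. norm (scaleC (cinner y (T (e n))) (e n)))"
      unfolding S_def by (rule summable_norm[OF absS])
    also have "\<dots> \<le> (\<Sum>n. norm y * norm (T (e n)))"
      by (rule suminf_le[OF bound absS summable_mult[OF summ]])
    finally show ?thesis by (simp add: suminf_mult[OF summ])
  qed
  then have "bounded_linear S"
    by (rule bounded_linear_intro[rotated 2]) (simp_all add: Sadd SscaleC scaleR_scaleC)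
  moreover have "cinner (T x) y = cinner x (S y)" for x y
  proof -
    have "(\<lambda>n. cinner (T (scaleC (cinner x (e n)) (e n))) y) sums cinner (T x) y"
      by (rule bounded_linear.sums[OF bounded_linear_cinner_left bounded_linear.sums[OF blT expand]])
    moreover have "cinner (T (scaleC (cinner x (e n)) (e n))) y =
        cinner x (scaleC (cinner y (T (e n))) (e n))" for n
      by (simp add: cT cinner_scaleC_left cinner_scaleC_right cinner_commute[of "T (e n)" y])
    ultimately have "(\<lambda>n. cinner x (scaleC (cinner y (T (e n))) (e n))) sums cinner (T x) y"
      by (simp only:)
    then show ?thesis
      using bounded_linear.sums[OF bounded_linear_cinner_right sumS] by (rule sums_unique2)
  qed
  ultimately show ?thesis
    unfolding adjoint_operator_def bounded_operator_def using SscaleC by blast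
qed

text \<open>
  The trace of \<open>\<bar>T\<bar>\<close> is bounded by the given sum because \<open>\<langle>\<bar>T\<bar> e, e\<rangle> \<le> \<parallel>\<bar>T\<bar> e\<parallel> = \<parallel>T e\<parallel>\<close> for every
  unit vector \<open>e\<close>.
\<close>

lemma trace_class_if_summable_norm:
  fixes T :: "'a::complex_hilbert \<Rightarrow> 'a" and e :: "nat \<Rightarrow> 'a"
  assumes T: "bounded_operator T"
    and orth: "\<And>m n. cinner (e m) (e n) = (if m = n then 1 else 0)"
    and expand: "\<And>x. (\<lambda>n. scaleC (cinner x (e n)) (e n)) sums x"
    and summ: "summable (\<lambda>n. norm (T (e n)))"
  shows "trace_class T"
proof -
  have unit: "norm (e n) = 1" for n
    using orth[of n n] cinner_self[of "e n"] norm_ge_zero[of "e n"]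
    by (metis of_real_eq_1_iff power2_eq_1_iff linorder_not_le zero_less_one neg_less_0_iff_less)
  have inj: "inj e" using orth by (metis injI zero_neq_one)
  obtain A where A: "absolute_value T A"
    using adjoint_exists_if_summable_norm[OF T unit expand summ] absolute_value_exists[OF T] by blast
  then obtain S where pos: "positive_operator A" and S: "adjoint_operator T S"
    and AA: "A \<circ> A = S \<circ> T" by (auto simp: absolute_value_def)
  have normA: "norm (A x) = norm (T x)" for x
  proof -
    have real: "cinner (A u) u = cnj (cinner (A u) u)" for u
      using pos by (simp add: positive_operator_def complex_eq_iff)
    have lin: "A (u + v) = A u + A v" "A (scaleC a u) = scaleC a (A u)" for u v a
      using pos by (auto simp: positive_operator_def bounded_operator_def bounded_linear_def linear_add)
    \<comment> \<open>A positive operator is self-adjoint, by polarisation with \<open>u + v\<close> and \<open>u + \<i> v\<close>.\<close>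
    have selfadj: "cinner (A u) v = cinner u (A v)" for u v
    proof -
      define p q where "p = cinner (A u) v" and "q = cinner (A v) u"
      have "p + q = cnj (p + q)"
        using real[of "u + v"] real[of u] real[of v]
        by (simp add: lin cinner_add_left cinner_add_right p_def q_def complex_eq_iff)
      moreover have "\<i> * q - \<i> * p = cnj (\<i> * q - \<i> * p)"
        using real[of "u + scaleC \<i> v"] real[of u] real[of v]
        by (simp add: lin cinner_add_left cinner_add_right cinner_scaleC_left cinner_scaleC_right
            p_def q_def complex_eq_iff)
      ultimately have "p = cnj q" by (auto simp: complex_eq_iff)
      then show ?thesis by (simp add: p_def q_def cinner_commute[of "A v" u])
    qed
    have "cinner (A x) (A x) = cinner (T x) (T x)"
    proof -
      have "cinner (A x) (A x) = cinner x (A (A x))" by (rule selfadj)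
      also have "A (A x) = S (T x)" using AA by (simp add: fun_eq_iff)
      also have "cinner x (S (T x)) = cinner (T x) (T x)"
        using S by (simp add: adjoint_operator_def)
      finally show ?thesis .
    qed
    then have "(norm (A x))\<^sup>2 = (norm (T x))\<^sup>2"
      unfolding cinner_self by (simp only: of_real_eq_iff)
    then show ?thesis by simp
  qed
  have "(\<lambda>n. Re (cinner (A (e n)) (e n))) summable_on UNIV"
  proof (rule norm_summable_imp_summable_on, rule summable_comparison_test'[OF summ, of 0])
    fix n
    have "\<bar>Re (cinner (A (e n)) (e n))\<bar> \<le> cmod (cinner (A (e n)) (e n))" by (rule abs_Re_le_cmod)
    also have "\<dots> \<le> norm (A (e n)) * norm (e n)" by (rule cinner_Cauchy_Schwarz)
    finally show "norm (norm (Re (cinner (A (e n)) (e n)))) \<le> norm (T (e n))"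
      by (simp add: unit normA)
  qed
  then have "(\<lambda>x. Re (cinner (A x) x)) summable_on range e"
    using summable_on_reindex[OF inj, of "\<lambda>x. Re (cinner (A x) x)"] by (simp add: o_def)
  moreover have "orthonormal_basis (range e)"
    unfolding orthonormal_basis_def
  proof (intro conjI ballI allI impI)
    show "cinner x y = (if x = y then 1 else 0)" if "x \<in> range e" "y \<in> range e" for x y
      using that orth inj by (auto simp: inj_eq)
    show "x = 0" if "\<forall>y\<in>range e. cinner x y = 0" for x
    proof -
      have "(\<lambda>n. 0) sums x" using expand[of x] that by (simp add: scaleC_zero_left)
      then show ?thesis using sums_0 sums_unique2 by blast
    qed
  qed
  ultimately show ?thesis using A T unfolding trace_class_def by blast
qed

section \<open>Weighted Hardy spaces\<close>

text \<open>
  The common frame for \<open>H\<^sup>2\<close> (weights 1) and the Dirichlet space (weights \<open>max 1 n\<close>): a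
  Hilbert space whose elements are represented by analytic functions on the disc, with a
  weighted square sum of the Taylor coefficients as norm.  The lower bound on the weights makes
  point evaluations bounded; the upper bound limits the growth of the norms of \<open>z\<^sup>n\<close>.
\<close>

locale weighted_hardy_space =
  fixes ev :: "'a::complex_hilbert \<Rightarrow> complex \<Rightarrow> complex" and w :: "nat \<Rightarrow> real"
  assumes weight_ge_1: "1 \<le> w n"
    and weight_le: "w n \<le> real n + 1"
    and ev_analytic: "ev f \<in> disc_analytic"
    and ev_wsummable: "wsummable w (taylor_coeff (ev f))"
    and ev_surj: "h \<in> disc_analytic \<Longrightarrow> wsummable w (taylor_coeff h) \<Longrightarrow> \<exists>f. ev f = h"
    and ev_add: "ev (f + g) = (\<lambda>z. ev f z + ev g z)"
    and ev_scaleC: "ev (scaleC a f) = (\<lambda>z. a * ev f z)"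
    and cinner_wsum: "cinner f g = wsum w (taylor_coeff (ev f)) (taylor_coeff (ev g))"
begin

abbreviation coeff :: "'a \<Rightarrow> nat \<Rightarrow> complex" where
  "coeff f \<equiv> taylor_coeff (ev f)"

lemma coeff_add: "coeff (f + g) n = coeff f n + coeff g n"
  by (simp add: ev_add taylor_coeff_add ev_analytic)

lemma coeff_scaleC: "coeff (scaleC a f) n = a * coeff f n"
  by (simp add: ev_scaleC taylor_coeff_cmult ev_analytic)

lemma coeff_diff: "coeff (f - g) n = coeff f n - coeff g n"
  using coeff_add[of "f - g" g n] by simp

lemma norm_sq: "(norm f)\<^sup>2 = (\<Sum>n. w n * (cmod (coeff f n))\<^sup>2)"
proof -
  have "complex_of_real ((norm f)\<^sup>2) = of_real (\<Sum>n. w n * (cmod (coeff f n))\<^sup>2)"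
    unfolding cinner_self[symmetric] cinner_wsum by (rule wsum_self[OF ev_wsummable])
  then show ?thesis by (simp only: of_real_eq_iff)
qed

lemma coeff_le_norm: "cmod (coeff f n) \<le> norm f"
  using weighted_term_le[OF weight_ge_1 ev_wsummable, of f "(norm f)\<^sup>2" n]
  by (simp add: norm_sq[symmetric] power2_le_iff_abs_le)

lemma norm_ev_le:
  assumes z: "z \<in> ball 0 1"
  shows "cmod (ev f z) \<le> norm f * (1 / (1 - cmod z))"
proof -
  have geo: "(\<lambda>n. norm f * cmod z ^ n) sums (norm f * (1 / (1 - cmod z)))"
    using z by (intro sums_mult geometric_sums) simp
  have le: "cmod (coeff f n * z ^ n) \<le> norm f * cmod z ^ n" for n
    by (simp add: norm_mult norm_power coeff_le_norm mult_right_mono)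
  have abs: "summable (\<lambda>n. cmod (coeff f n * z ^ n))"
    by (rule summable_comparison_test'[OF sums_summable[OF geo], of 0]) (use le in simp)
  have "cmod (ev f z) = cmod (\<Sum>n. coeff f n * z ^ n)"
    using taylor_coeff_sums[OF ev_analytic z, of f] by (simp add: sums_iff)
  also have "\<dots> \<le> (\<Sum>n. cmod (coeff f n * z ^ n))" by (rule summable_norm[OF abs])
  also have "\<dots> \<le> (\<Sum>n. norm f * cmod z ^ n)"
    by (rule suminf_le[OF le abs sums_summable[OF geo]])
  also have "\<dots> = norm f * (1 / (1 - cmod z))" by (rule sums_unique[OF geo, symmetric])
  finally show ?thesis .
qed

lemma bounded_linear_ev:
  assumes "z \<in> ball 0 1"
  shows "bounded_linear (\<lambda>f. ev f z)"
  by (rule bounded_linear_intro[OF _ _ norm_ev_le[OF assms]])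
     (simp_all add: ev_add scaleR_scaleC ev_scaleC scaleR_conv_of_real)

definition monomial :: "nat \<Rightarrow> 'a" where
  "monomial n = (SOME f. coeff f = (\<lambda>k. if k = n then 1 else 0))"

lemma coeff_monomial: "coeff (monomial n) = (\<lambda>k. if k = n then 1 else 0)"
proof -
  have "cmod (if k = n then 1 else 0) \<le> 1" for k by simp
  then obtain g where g: "g \<in> disc_analytic" "taylor_coeff g = (\<lambda>k. if k = n then 1 else 0)"
    using taylor_coeff_realize[of "\<lambda>k. if k = n then 1 else 0" 1] by (auto simp: fun_eq_iff)
  have "(\<lambda>k. w k * (cmod (if k = n then 1 else 0 :: complex))\<^sup>2) = (\<lambda>k. if k = n then w k else 0)"
    by auto
  then have "wsummable w (taylor_coeff g)"
    unfolding wsummable_def g(2) by (simp only: summable_single)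
  from ev_surj[OF g(1) this] obtain f where "ev f = g" ..
  then have "coeff f = (\<lambda>k. if k = n then 1 else 0)" using g(2) by simp
  then show ?thesis unfolding monomial_def by (rule someI)
qed

lemma ev_monomial:
  assumes "z \<in> ball 0 1"
  shows "ev (monomial n) z = z ^ n"
proof -
  have "(\<lambda>k. if k = n then z ^ k else 0) sums ev (monomial n) z"
    using taylor_coeff_sums[OF ev_analytic[of "monomial n"] assms]
    by (simp add: coeff_monomial if_distrib[of "\<lambda>c. c * _"] cong: if_cong)
  then show ?thesis using sums_single[of n "\<lambda>k. z ^ k"] sums_unique2 by blast
qed

lemma cinner_monomial: "cinner f (monomial n) = of_real (w n) * coeff f n"
proof -
  have "(\<lambda>k. of_real (w k) * coeff f k * cnj (coeff (monomial n) k)) =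
      (\<lambda>k. if k = n then of_real (w k) * coeff f k else 0)"
    by (auto simp: coeff_monomial)
  then show ?thesis
    unfolding cinner_wsum wsum_def
    using sums_unique[OF sums_single[of n "\<lambda>k. of_real (w k) * coeff f k"]] by simp
qed

lemma norm_monomial_sq: "(norm (monomial n))\<^sup>2 = w n"
proof -
  have "complex_of_real ((norm (monomial n))\<^sup>2) = of_real (w n)"
    unfolding cinner_self[symmetric] cinner_monomial by (simp add: coeff_monomial)
  then show ?thesis by (simp only: of_real_eq_iff)
qed

lemma monomial_expansion: "(\<lambda>n. scaleC (coeff f n) (monomial n)) sums f"
proof -
  define p where "p N = (\<Sum>n<N. scaleC (coeff f n) (monomial n))" for N
  have "ev 0 = (\<lambda>z. 0)" using ev_scaleC[of 0 f] by (simp add: scaleC_zero_left)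
  then have coeff_p: "coeff (p N) k = (if k < N then coeff f k else 0)" for N k
    by (induction N) (auto simp: p_def coeff_add coeff_scaleC coeff_monomial taylor_coeff_zero less_Suc_eq)
  have summ: "summable (\<lambda>n. w n * (cmod (coeff f n))\<^sup>2)"
    using ev_wsummable by (simp add: wsummable_def)
  have tail: "(norm (f - p N))\<^sup>2 = (norm f)\<^sup>2 - (\<Sum>n<N. w n * (cmod (coeff f n))\<^sup>2)" for N
  proof -
    have "(norm (f - p N))\<^sup>2 =
        (\<Sum>n. w n * (cmod (coeff f n))\<^sup>2 - (if n < N then w n * (cmod (coeff f n))\<^sup>2 else 0))"
      unfolding norm_sq by (intro suminf_cong) (simp add: coeff_diff coeff_p)
    also have "\<dots> = (norm f)\<^sup>2 - (\<Sum>n. if n \<in> {..<N} then w n * (cmod (coeff f n))\<^sup>2 else 0)"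
      unfolding norm_sq
      using suminf_diff[OF summ sums_summable[OF sums_If_finite_set[of "{..<N}"]]] by simp
    finally show ?thesis
      using sums_unique[OF sums_If_finite_set[of "{..<N}" "\<lambda>n. w n * (cmod (coeff f n))\<^sup>2"]] by simp
  qed
  have "(\<lambda>N. (norm (f - p N))\<^sup>2) \<longlonglongrightarrow> (norm f)\<^sup>2 - (norm f)\<^sup>2"
    unfolding tail by (intro tendsto_diff tendsto_const) (simp add: norm_sq summable_LIMSEQ summ)
  then have "(\<lambda>N. sqrt ((norm (f - p N))\<^sup>2)) \<longlonglongrightarrow> sqrt 0"
    by (intro tendsto_real_sqrt) simp
  then have "(\<lambda>N. norm (p N - f)) \<longlonglongrightarrow> 0" by (simp add: norm_minus_commute)
  then have "p \<longlonglongrightarrow> f" by (simp add: LIM_zero_cancel tendsto_norm_zero_iff)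
  then show ?thesis by (simp add: sums_def p_def[abs_def])
qed

lemma trace_class_if_summable_norm_monomials:
  assumes T: "bounded_operator T" and summ: "summable (\<lambda>n. norm (T (monomial n)))"
  shows "trace_class T"
proof (rule trace_class_if_summable_norm[OF T])
  define e where "e n = scaleC (of_real (1 / sqrt (w n))) (monomial n)" for n
  have w: "w n > 0" "sqrt (w n) * sqrt (w n) = w n" for n
    using weight_ge_1[of n] by auto
  have w': "complex_of_real (sqrt (w n)) * of_real (sqrt (w n)) = of_real (w n)" for n
    by (simp only: of_real_mult[symmetric] w(2))
  show "cinner (e m) (e n) = (if m = n then 1 else 0)" for m n
    using w(1)[of n] w'[of n]
    by (simp add: e_def cinner_scaleC_left cinner_scaleC_right cinner_monomial coeff_scaleC coeff_monomial)
  show "(\<lambda>n. scaleC (cinner f (e n)) (e n)) sums f" for f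
  proof -
    have "scaleC (cinner f (e n)) (e n) = scaleC (coeff f n) (monomial n)" for n
      using w(1)[of n] w'[of n]
      by (simp add: e_def cinner_scaleC_right cinner_monomial scaleC_scaleC field_simps)
    then show ?thesis using monomial_expansion[of f] by simp
  qed
  show "summable (\<lambda>n. norm (T (e n)))"
  proof (rule summable_comparison_test'[OF summ, of 0])
    fix n
    have "norm (T (e n)) = 1 / sqrt (w n) * norm (T (monomial n))"
      using T w(1)[of n] by (simp add: bounded_operator_def e_def norm_scaleC norm_divide)
    also have "\<dots> \<le> 1 * norm (T (monomial n))"
      using weight_ge_1[of n] by (intro mult_right_mono) auto
    finally show "norm (norm (T (e n))) \<le> norm (T (monomial n))" by simp
  qed
qed

end

section \<open>Analytic extension of the semiflow to the sector\<close>

text \<open>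
  A normal families form of the Schwarz--Pick lemma.  Otherwise functions of the family would
  converge to a function bounded by 1 that has modulus 1 at \<open>b\<close>, hence is constant, although
  its value at \<open>a\<close> has modulus less than 1.
\<close>

lemma uniform_bound_transfer:
  assumes S: "open S" "connected S" and a: "a \<in> S" and b: "b \<in> S"
    and hol: "\<And>f. f \<in> F \<Longrightarrow> f holomorphic_on S"
    and le1: "\<And>f x. f \<in> F \<Longrightarrow> x \<in> S \<Longrightarrow> cmod (f x) \<le> 1"
    and r: "r < 1" "\<And>f. f \<in> F \<Longrightarrow> cmod (f a) \<le> r"
  shows "\<exists>s<1. \<forall>f\<in>F. cmod (f b) \<le> s"
proof (rule ccontr)
  assume neg: "\<not> (\<exists>s<1. \<forall>f\<in>F. cmod (f b) \<le> s)"
  have "\<exists>f\<in>F. cmod (f b) > 1 - inverse (real (Suc n))" for n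
  proof -
    have "1 - inverse (real (Suc n)) < 1" by simp
    then show ?thesis using neg by (meson not_le)
  qed
  then obtain h where h: "\<And>n. h n \<in> F" "\<And>n. cmod (h n b) > 1 - inverse (real (Suc n))"
    by metis
  obtain g k where g: "g holomorphic_on S" and k: "strict_mono (k :: nat \<Rightarrow> nat)"
    and lim: "\<And>x. x \<in> S \<Longrightarrow> ((\<lambda>n. h (k n) x) \<longlongrightarrow> g x) sequentially"
  proof (rule Montel[OF S(1) hol, of F h])
    show "\<exists>B. \<forall>h\<in>F. \<forall>z\<in>K. cmod (h z) \<le> B" if "compact K" "K \<subseteq> S" for K
      using le1 that by blast
  qed (use h in auto)
  have gle1: "cmod (g x) \<le> 1" if "x \<in> S" for x
    by (rule LIMSEQ_le_const2[OF tendsto_norm[OF lim[OF that]]]) (use le1 h that in blast)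
  have "(\<lambda>n. 1 - inverse (real (Suc n))) \<longlonglongrightarrow> 1 - 0"
    by (intro tendsto_diff tendsto_const LIMSEQ_inverse_real_of_nat)
  from LIMSEQ_subseq_LIMSEQ[OF this k] have "1 - 0 \<le> cmod (g b)"
    by (rule LIMSEQ_le[OF _ tendsto_norm[OF lim[OF b]]]) (use h(2) in \<open>auto intro!: exI[of _ 0] less_imp_le\<close>)
  then have "cmod (g x) \<le> cmod (g b)" if "x \<in> S" for x
    using gle1[OF that] by linarith
  then have "g constant_on S"
    by (rule maximum_modulus_principle[OF g S S(1) order_refl b])
  then have "g a = g b" using a b by (auto simp: constant_on_def)
  moreover have "cmod (g a) \<le> r"
    by (rule LIMSEQ_le_const2[OF tendsto_norm[OF lim[OF a]]]) (use r h in blast)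
  ultimately show False using \<open>1 - 0 \<le> cmod (g b)\<close> r(1) by simp
qed

lemma open_connected_sector: "open (sector \<theta> - {0})" "connected (sector \<theta> - {0})"
proof -
  define V where "V = {z. \<bar>Im z\<bar> < \<theta>}"
  have V: "V = Im -` {-\<theta><..<\<theta>}" by (auto simp: V_def)
  have "open V" unfolding V by (intro open_vimage continuous_intros)
  have "convex V"
    unfolding V by (intro convex_linear_vimage bounded_linear.linear[OF bounded_linear_Im]) auto
  have eq: "sector \<theta> - {0} = exp ` V"
  proof (intro equalityI subsetI)
    fix z assume "z \<in> sector \<theta> - {0}"
    then obtain r \<alpha> where z: "z = of_real r * cis \<alpha>" "r > 0" "\<bar>\<alpha>\<bar> < \<theta>"
      by (force simp: sector_def)
    then have "z = exp (Complex (ln r) \<alpha>)" "Complex (ln r) \<alpha> \<in> V"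
      by (simp_all add: exp_eq_polar V_def)
    then show "z \<in> exp ` V" by blast
  next
    fix z assume "z \<in> exp ` V"
    then obtain v where "z = exp v" "\<bar>Im v\<bar> < \<theta>" by (auto simp: V_def)
    then have "z = of_real (exp (Re v)) * cis (Im v)" "z \<noteq> 0"
      by (simp_all add: exp_eq_polar[symmetric])
    then show "z \<in> sector \<theta> - {0}"
      using \<open>\<bar>Im v\<bar> < \<theta>\<close> unfolding sector_def
      by (intro DiffI CollectI exI[of _ "exp (Re v)"] exI[of _ "Im v"]) auto
  qed
  show "connected (sector \<theta> - {0})"
    unfolding eq using \<open>convex V\<close>
    by (intro connected_continuous_image convex_connected continuous_intros)
  show "open (sector \<theta> - {0})"
    unfolding eq
  proof (rule open_mapping_thm[of exp UNIV])
    show "\<not> exp constant_on (UNIV :: complex set)"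
    proof
      assume "exp constant_on (UNIV :: complex set)"
      then have "exp (0::complex) = exp (of_real 1)" by (metis constant_on_def UNIV_I)
      then show False by (simp only: exp_of_real) (simp add: exp_eq_one_iff)
    qed
  qed (use \<open>open V\<close> in \<open>auto intro: holomorphic_intros\<close>)
qed

lemma of_real_in_sector: "0 < \<theta> \<Longrightarrow> 0 < t \<Longrightarrow> of_real t \<in> sector \<theta> - {0}"
  unfolding sector_def by (intro DiffI CollectI exI[of _ t] exI[of _ 0]) auto

text \<open>
  Otherwise \<open>K (n + 1)\<close> would bound the exponentially growing sequence \<open>(c\<^sup>2)\<^sup>n\<close>.
\<close>

lemma le_1_if_powers_sublinear:
  fixes c K :: real
  assumes c: "0 \<le> c" and K: "\<And>n. (c ^ n)\<^sup>2 \<le> K * (real n + 1)"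
  shows "c \<le> 1"
proof (rule ccontr)
  assume "\<not> c \<le> 1"
  then have c1: "1 < c" by simp
  define x where "x = inverse (c\<^sup>2)"
  have "norm x < 1"
    using c1 by (simp add: x_def inverse_less_1_iff one_less_power)
  then have "(\<lambda>n. K * (of_nat n * x ^ n + x ^ n)) \<longlonglongrightarrow> K * (0 + 0)"
    by (intro tendsto_intros powser_times_n_limit_0 LIMSEQ_power_zero)
  moreover have "1 \<le> K * (of_nat n * x ^ n + x ^ n)" for n
  proof -
    have "1 = (c ^ n)\<^sup>2 * x ^ n"
      using c1 by (simp add: x_def power_inverse power_mult[symmetric] mult.commute)
    also have "\<dots> \<le> K * (real n + 1) * x ^ n"
      using K[of n] c1 by (intro mult_right_mono) (simp_all add: x_def)
    finally show ?thesis by (simp add: algebra_simps)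
  qed
  ultimately have "1 \<le> K * (0 + 0)" by (intro LIMSEQ_le_const) auto
  then show False by simp
qed

context weighted_hardy_space
begin

lemma ev_operator_analytic_holomorphic:
  assumes S: "operator_analytic_on S U" and z: "z \<in> ball 0 1"
  shows "(\<lambda>\<xi>. ev (blinfun_apply (S \<xi>) f) z) holomorphic_on U"
  unfolding holomorphic_on_def
proof
  fix \<xi> assume "\<xi> \<in> U"
  then obtain D where D: "bounded_operator (blinfun_apply D)"
    and der: "(S has_derivative (\<lambda>h. Blinfun (\<lambda>x. scaleC h (D x)))) (at \<xi>)"
    using S unfolding operator_analytic_on_def by blast
  have "bounded_linear (\<lambda>x. scaleC h (D x))" for h
    by (rule bounded_linear_compose[OF bounded_linear_scaleC blinfun.bounded_linear_right])
  then have B: "blinfun_apply (Blinfun (\<lambda>x. scaleC h (D x))) f = scaleC h (D f)" for h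
    by (simp add: bounded_linear_Blinfun_apply)
  have "((\<lambda>\<xi>. ev (blinfun_apply (S \<xi>) f) z) has_derivative
      (\<lambda>h. ev (blinfun_apply (Blinfun (\<lambda>x. scaleC h (D x))) f) z)) (at \<xi>)"
    by (rule bounded_linear.has_derivative[OF bounded_linear_ev[OF z]
          bounded_linear.has_derivative[OF blinfun.bounded_linear_left der]])
  then have "((\<lambda>\<xi>. ev (blinfun_apply (S \<xi>) f) z) has_field_derivative ev (D f) z) (at \<xi>)"
    unfolding has_field_derivative_def B ev_scaleC by (simp only: mult.commute[of _ "ev (D f) z"])
  then show "(\<lambda>\<xi>. ev (blinfun_apply (S \<xi>) f) z) field_differentiable at \<xi> within U"
    by (meson field_differentiable_at_within field_differentiable_def)
qed

text \<open>
  The function \<open>\<Phi> \<xi> = (S \<xi> id) z\<close> continues \<open>t \<mapsto> \<phi>\<^sub>t z\<close> to the sector.  By the identity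
  theorem \<open>S \<xi>\<close> is still multiplicative on powers, so \<open>(\<Phi> \<xi>)\<^sup>n = (S \<xi> id\<^sup>n) z\<close>, which is bounded
  by a multiple of \<open>\<parallel>id\<^sup>n\<parallel>\<close>.  As this grows slower than any exponential, \<open>\<bar>\<Phi> \<xi>\<bar> \<le> 1\<close>.
\<close>

lemma semiflow_extension:
  assumes \<theta>: "0 < \<theta>"
    and S: "operator_analytic_on S (sector \<theta> - {0})"
    and S_T: "\<And>t. 0 < t \<Longrightarrow> blinfun_apply (S (of_real t)) = T t"
    and T: "\<And>t. 0 < t \<Longrightarrow> composition_operator ev (\<phi> t) (T t)"
    and \<phi>: "\<And>t. 0 < t \<Longrightarrow> \<phi> t ` ball 0 1 \<subseteq> ball 0 1"
    and z: "z \<in> ball 0 1"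
  obtains \<Phi> where "\<Phi> holomorphic_on sector \<theta> - {0}"
    and "\<And>\<xi>. \<xi> \<in> sector \<theta> - {0} \<Longrightarrow> cmod (\<Phi> \<xi>) \<le> 1"
    and "\<And>t. 0 < t \<Longrightarrow> \<Phi> (of_real t) = \<phi> t z"
proof -
  define \<Psi> where "\<Psi> n \<xi> = ev (blinfun_apply (S \<xi>) (monomial n)) z" for n \<xi>
  have hol: "\<Psi> n holomorphic_on sector \<theta> - {0}" for n
    unfolding \<Psi>_def by (rule ev_operator_analytic_holomorphic[OF S z])
  have real: "\<Psi> n (of_real t) = \<phi> t z ^ n" if "0 < t" for n t
  proof -
    have "\<Psi> n (of_real t) = ev (monomial n) (\<phi> t z)"
      using T[OF that] z by (simp add: \<Psi>_def S_T[OF that] composition_operator_def)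
    also have "\<dots> = \<phi> t z ^ n" using \<phi>[OF that] z by (intro ev_monomial) blast
    finally show ?thesis .
  qed
  have power: "\<Psi> n \<xi> = \<Psi> 1 \<xi> ^ n" if \<xi>: "\<xi> \<in> sector \<theta> - {0}" for n \<xi>
  proof -
    have "\<Psi> n \<xi> - \<Psi> 1 \<xi> ^ n = 0"
    proof (rule analytic_continuation[of "\<lambda>\<xi>. \<Psi> n \<xi> - \<Psi> 1 \<xi> ^ n" "sector \<theta> - {0}"
          "of_real ` {0<..}" "of_real 1" \<xi>])
      show "(\<lambda>\<xi>. \<Psi> n \<xi> - \<Psi> 1 \<xi> ^ n) holomorphic_on sector \<theta> - {0}"
        by (intro holomorphic_intros hol)
      show "of_real ` {0<..} \<subseteq> sector \<theta> - {0}"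
        by (rule image_subsetI, rule of_real_in_sector[OF \<theta>]) simp
      show "complex_of_real 1 \<in> sector \<theta> - {0}"
        by (rule of_real_in_sector[OF \<theta>]) simp
      show "complex_of_real 1 islimpt of_real ` {0<..}"
      proof (rule islimptI)
        fix U assume "complex_of_real 1 \<in> U" "open U"
        then obtain d where d: "d > 0" "ball (complex_of_real 1) d \<subseteq> U"
          by (meson open_contains_ball)
        then have "dist (complex_of_real 1) (of_real (1 + d/2)) < d"
          by (simp only: dist_of_real) (simp add: dist_real_def)
        then have "complex_of_real (1 + d/2) \<in> U" using d(2) by auto
        moreover have "complex_of_real (1 + d/2) \<in> of_real ` {0<..}"
          using d(1) by (intro imageI) auto
        moreover have "complex_of_real (1 + d/2) \<noteq> of_real 1"
          using d(1) by (simp only: of_real_eq_iff)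
        ultimately show "\<exists>y\<in>of_real ` {0<..}. y \<in> U \<and> y \<noteq> complex_of_real 1" by blast
      qed
      show "\<Psi> n x - \<Psi> 1 x ^ n = 0" if "x \<in> of_real ` {0<..}" for x
        using that real by auto
    qed (use \<xi> open_connected_sector in auto)
    then show ?thesis by simp
  qed
  show thesis
  proof (rule that[of "\<Psi> 1"])
    show "\<Psi> 1 holomorphic_on sector \<theta> - {0}" by (rule hol)
    show "\<Psi> 1 (of_real t) = \<phi> t z" if "0 < t" for t using real[OF that, of 1] by simp
    show "cmod (\<Psi> 1 \<xi>) \<le> 1" if \<xi>: "\<xi> \<in> sector \<theta> - {0}" for \<xi>
    proof (rule le_1_if_powers_sublinear)
      define K where "K = norm (S \<xi>) * (1 / (1 - cmod z))"
      fix n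
      have "cmod (\<Psi> 1 \<xi>) ^ n = cmod (\<Psi> n \<xi>)" by (simp add: power[OF \<xi>, of n] norm_power)
      also have "\<dots> \<le> norm (blinfun_apply (S \<xi>) (monomial n)) * (1 / (1 - cmod z))"
        unfolding \<Psi>_def by (rule norm_ev_le[OF z])
      also have "\<dots> \<le> norm (S \<xi>) * norm (monomial n) * (1 / (1 - cmod z))"
        using z by (intro mult_right_mono norm_blinfun) auto
      finally have "cmod (\<Psi> 1 \<xi>) ^ n \<le> K * norm (monomial n)" by (simp add: K_def mult_ac)
      then have "(cmod (\<Psi> 1 \<xi>) ^ n)\<^sup>2 \<le> (K * norm (monomial n))\<^sup>2"
        by (intro power_mono) auto
      also have "\<dots> = K\<^sup>2 * w n" by (simp add: power_mult_distrib norm_monomial_sq)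
      also have "\<dots> \<le> K\<^sup>2 * (real n + 1)" by (intro mult_left_mono weight_le) simp
      finally show "(cmod (\<Psi> 1 \<xi>) ^ n)\<^sup>2 \<le> K\<^sup>2 * (real n + 1)" .
    qed simp  qed
qed

end

lemma norm_le_disc_sup_norm:
  assumes "f ` ball 0 1 \<subseteq> ball 0 1" "z \<in> ball 0 1"
  shows "cmod (f z) \<le> disc_sup_norm f"
  unfolding disc_sup_norm_def
proof (rule cSUP_upper[OF assms(2)])
  show "bdd_above ((\<lambda>z. cmod (f z)) ` ball 0 1)"
    using assms(1) by (intro bdd_aboveI[of _ 1]) force
qed

lemma (in weighted_hardy_space) disc_sup_norm_less_1_transfer:
  assumes an: "analytic_semigroup T"
    and T: "\<And>t. 0 < t \<Longrightarrow> composition_operator ev (\<phi> t) (T t)"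
    and \<phi>: "\<And>t. 0 < t \<Longrightarrow> \<phi> t ` ball 0 1 \<subseteq> ball 0 1"
    and t0: "0 < t0" "disc_sup_norm (\<phi> t0) < 1" and t: "0 < t"
  shows "disc_sup_norm (\<phi> t) < 1"
proof -
  obtain \<theta> S where \<theta>: "0 < \<theta>" and S_T: "\<And>t. 0 \<le> t \<Longrightarrow> blinfun_apply (S (of_real t)) = T t"
    and S: "operator_analytic_on S (sector \<theta> - {0})"
    using an unfolding analytic_semigroup_def by blast
  have "\<exists>\<Phi>. \<Phi> holomorphic_on sector \<theta> - {0} \<and> (\<forall>\<xi>\<in>sector \<theta> - {0}. cmod (\<Phi> \<xi>) \<le> 1) \<and>
      (\<forall>t>0. \<Phi> (of_real t) = \<phi> t z)" if "z \<in> ball 0 1" for z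
    by (rule semiflow_extension[where \<phi> = \<phi>, OF \<theta> S S_T[OF less_imp_le] T \<phi> that]) blast+
  then obtain \<Phi> where hol: "\<And>z. z \<in> ball 0 1 \<Longrightarrow> \<Phi> z holomorphic_on sector \<theta> - {0}"
    and le1: "\<And>z \<xi>. z \<in> ball 0 1 \<Longrightarrow> \<xi> \<in> sector \<theta> - {0} \<Longrightarrow> cmod (\<Phi> z \<xi>) \<le> 1"
    and real: "\<And>z t. z \<in> ball 0 1 \<Longrightarrow> 0 < t \<Longrightarrow> \<Phi> z (of_real t) = \<phi> t z"
    by metis
  have "\<exists>s<1. \<forall>f\<in>\<Phi> ` ball 0 1. cmod (f (of_real t)) \<le> s"
  proof (rule uniform_bound_transfer[OF open_connected_sector, of _ \<theta>, OF _ _ _ _ t0(2)])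
    show "cmod (f (of_real t0)) \<le> disc_sup_norm (\<phi> t0)" if "f \<in> \<Phi> ` ball 0 1" for f
      using that real t0(1) norm_le_disc_sup_norm[OF \<phi>[OF t0(1)]] by auto
  qed (use hol le1 of_real_in_sector[OF \<theta>] t t0 in auto)
  then obtain s where "s < 1" "\<And>z. z \<in> ball 0 1 \<Longrightarrow> cmod (\<phi> t z) \<le> s"
    using real t by auto
  then show ?thesis
    unfolding disc_sup_norm_def by (intro order_le_less_trans[OF cSUP_least]) auto
qed

section \<open>Square means over circles\<close>

lemma has_integral_cis_mult_cnj:
  "((\<lambda>t. cis (real k * t) * cnj (cis (real l * t))) has_integral (if k = l then 2 * pi else 0))
    {0..2 * pi}"
proof (cases "k = l")
  case True
  show ?thesis
    using True has_integral_const_real[of "1 :: complex" 0 "2 * pi"] by (simp add: cis_cnj cis_mult scaleR_conv_of_real)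
next
  case False
  define m where "m = real k - real l"
  have m: "m \<noteq> 0" using False by (simp add: m_def)
  define F where "F z = exp (\<i> * of_real m * z) / (\<i> * of_real m)" for z
  have F: "(F has_field_derivative exp (\<i> * of_real m * z)) (at z)" for z
    unfolding F_def using m by (auto intro!: derivative_eq_intros)
  have "((\<lambda>t. exp (\<i> * of_real m * of_real t)) has_integral (F (of_real (2 * pi)) - F (of_real 0))) {0..2 * pi}"
    by (rule fundamental_theorem_of_calculus) (auto intro!: has_vector_derivative_real_field[OF F])
  moreover have "F (of_real (2 * pi)) = F (of_real 0)"
  proof -
    have "exp (\<i> * of_real m * of_real (2 * pi)) = cis (2 * pi * m)"
      by (simp add: cis_conv_exp mult_ac)
    also have "\<dots> = 1" by (rule cis_multiple_2pi) (simp add: m_def)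
    finally show ?thesis by (simp add: F_def)
  qed
  moreover have "exp (\<i> * of_real m * of_real t) = cis (real k * t) * cnj (cis (real l * t))" for t
  proof -
    have "cis (real k * t) * cnj (cis (real l * t)) = cis (m * t)"
      by (simp add: cis_cnj cis_mult m_def algebra_simps)
    then show ?thesis by (simp add: cis_conv_exp mult_ac)
  qed
  ultimately show ?thesis using False by simp
qed

lemma parseval_finite:
  fixes a :: "nat \<Rightarrow> complex"
  shows "((\<lambda>t. (cmod (\<Sum>k<N. a k * cis (real k * t)))\<^sup>2) has_integral
    2 * pi * (\<Sum>k<N. (cmod (a k))\<^sup>2)) {0..2 * pi}"
proof -
  have "((\<lambda>t. \<Sum>k<N. \<Sum>l<N. (a k * cnj (a l)) * (cis (real k * t) * cnj (cis (real l * t)))) has_integral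
      (\<Sum>k<N. \<Sum>l<N. (a k * cnj (a l)) * (if k = l then 2 * pi else 0))) {0..2 * pi}"
    by (intro has_integral_sum has_integral_mult_right has_integral_cis_mult_cnj) auto
  moreover have "(\<Sum>k<N. \<Sum>l<N. (a k * cnj (a l)) * (cis (real k * t) * cnj (cis (real l * t)))) =
      of_real ((cmod (\<Sum>k<N. a k * cis (real k * t)))\<^sup>2)" for t
    unfolding complex_norm_square cnj_sum sum_product
    by (intro sum.cong refl) (simp add: mult_ac)
  moreover have "(\<Sum>k<N. \<Sum>l<N. (a k * cnj (a l)) * (if k = l then 2 * pi else 0)) =
      of_real (2 * pi * (\<Sum>k<N. (cmod (a k))\<^sup>2))"
  proof -
    have "(\<Sum>l<N. (a k * cnj (a l)) * (if k = l then 2 * pi else 0)) = of_real (2 * pi * (cmod (a k))\<^sup>2)"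
      if "k < N" for k
      using that
      by (simp add: if_distrib[of "\<lambda>c. _ * c"] if_distrib[of complex_of_real] complex_norm_square
          mult_ac cong: if_cong del: of_real_power)
    then have "(\<Sum>k<N. \<Sum>l<N. (a k * cnj (a l)) * (if k = l then 2 * pi else 0)) =
        (\<Sum>k<N. of_real (2 * pi * (cmod (a k))\<^sup>2))" by (intro sum.cong) auto
    also have "\<dots> = of_real (2 * pi * (\<Sum>k<N. (cmod (a k))\<^sup>2))"
      by (simp only: of_real_sum sum_distrib_left)
    finally show ?thesis .
  qed
  ultimately have "((\<lambda>t. of_real ((cmod (\<Sum>k<N. a k * cis (real k * t)))\<^sup>2) :: complex) has_integral
      of_real (2 * pi * (\<Sum>k<N. (cmod (a k))\<^sup>2))) {0..2 * pi}"
    by simp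
  from has_integral_Re[OF this] show ?thesis by (simp only: Re_complex_of_real)
qed

lemma parseval_circle:
  fixes c :: "nat \<Rightarrow> complex"
  assumes f: "\<And>z. z \<in> ball 0 1 \<Longrightarrow> (\<lambda>k. c k * z ^ k) sums f z" and \<rho>: "0 \<le> \<rho>" "\<rho> < 1"
  obtains s where "(\<lambda>k. (cmod (c k))\<^sup>2 * (\<rho>\<^sup>2) ^ k) sums s"
    and "((\<lambda>t. (cmod (f (of_real \<rho> * cis t)))\<^sup>2) has_integral 2 * pi * s) {0..2 * pi}"
proof -
  define a where "a k = c k * of_real \<rho> ^ k" for k
  have a_cis: "a k * cis (real k * t) = c k * (of_real \<rho> * cis t) ^ k" for k t
    by (simp only: a_def power_mult_distrib Complex.DeMoivre mult.assoc)
  \<comment> \<open>Convergence at a point of modulus between \<open>\<rho>\<close> and 1 makes the series absolutely convergent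
    on the circle of radius \<open>\<rho>\<close>.\<close>
  have "summable (\<lambda>k. c k * of_real ((1 + \<rho>) / 2) ^ k)"
    using \<rho> by (intro sums_summable[OF f]) (simp only: mem_ball_0 norm_of_real, simp)
  then have abs: "summable (\<lambda>k. cmod (a k))"
    unfolding a_def by (rule powser_insidea) (use \<rho> in \<open>simp only: norm_of_real, simp\<close>)
  have "uniform_limit {0..2 * pi} (\<lambda>N t. \<Sum>k<N. a k * cis (real k * t))
      (\<lambda>t. \<Sum>k. a k * cis (real k * t)) sequentially"
    by (rule Weierstrass_m_test[OF _ abs]) (simp add: norm_mult)
  moreover have "(\<Sum>k. a k * cis (real k * t)) = f (of_real \<rho> * cis t)" for t
    unfolding a_cis using \<rho> by (intro sums_unique[symmetric] f) (simp add: norm_mult)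
  ultimately have ul: "uniform_limit {0..2 * pi} (\<lambda>N t. \<Sum>k<N. a k * cis (real k * t))
      (\<lambda>t. f (of_real \<rho> * cis t)) sequentially" by simp
  have cont: "continuous_on {0..2 * pi} (\<lambda>t. \<Sum>k<N. a k * cis (real k * t))" for N
    by (intro continuous_intros)
  have "continuous_on {0..2 * pi} (\<lambda>t. cmod (f (of_real \<rho> * cis t)))"
    by (intro continuous_on_norm uniform_limit_theorem[OF always_eventually ul] allI cont) simp
  then have bd: "bounded ((\<lambda>t. cmod (f (of_real \<rho> * cis t))) ` {0..2 * pi})"
    by (intro compact_imp_bounded compact_continuous_image) auto
  have "uniform_limit {0..2 * pi} (\<lambda>N t. (cmod (\<Sum>k<N. a k * cis (real k * t)))\<^sup>2)
      (\<lambda>t. (cmod (f (of_real \<rho> * cis t)))\<^sup>2) sequentially"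
    unfolding power2_eq_square by (intro uniform_lim_mult uniform_limit_norm ul bd)
  then obtain I J where I: "\<And>N. ((\<lambda>t. (cmod (\<Sum>k<N. a k * cis (real k * t)))\<^sup>2) has_integral I N) {0..2 * pi}"
    and J: "((\<lambda>t. (cmod (f (of_real \<rho> * cis t)))\<^sup>2) has_integral J) {0..2 * pi}"
    and IJ: "I \<longlonglongrightarrow> J"
    by (rule uniform_limit_integral) (auto intro!: continuous_on_power continuous_on_norm cont)
  have "I N = 2 * pi * (\<Sum>k<N. (cmod (a k))\<^sup>2)" for N
    by (rule has_integral_unique[OF I parseval_finite])
  then have "(\<lambda>N. I N / (2 * pi)) = (\<lambda>N. \<Sum>k<N. (cmod (a k))\<^sup>2)" by (simp add: fun_eq_iff)
  moreover have "(\<lambda>N. I N / (2 * pi)) \<longlonglongrightarrow> J / (2 * pi)" by (intro tendsto_intros IJ) simp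
  ultimately have "(\<lambda>k. (cmod (a k))\<^sup>2) sums (J / (2 * pi))" by (simp add: sums_def)
  moreover have "(cmod (a k))\<^sup>2 = (cmod (c k))\<^sup>2 * (\<rho>\<^sup>2) ^ k" for k
    using \<rho> by (simp add: a_def norm_mult norm_power power_mult_distrib power_mult[symmetric] mult.commute)
  ultimately show thesis using J by (intro that[of "J / (2 * pi)"]) simp_all
qed

text \<open>
  By Parseval's identity both sums are means of \<open>\<bar>f\<bar>\<^sup>2\<close> and \<open>\<bar>g\<bar>\<^sup>2\<close> over the circle of radius
  \<open>sqrt x\<close>, where the pointwise inequality applies.  For \<open>f = h g\<close> with \<open>\<bar>h\<bar> \<le> M\<close> this bounds the
  effect of multiplication by \<open>h\<close> on the coefficients.
\<close>

lemma square_mean_le: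
  fixes a b :: "nat \<Rightarrow> complex"
  assumes f: "\<And>z. z \<in> ball 0 1 \<Longrightarrow> (\<lambda>k. a k * z ^ k) sums f z"
    and g: "\<And>z. z \<in> ball 0 1 \<Longrightarrow> (\<lambda>k. b k * z ^ k) sums g z"
    and le: "\<And>z. z \<in> ball 0 1 \<Longrightarrow> cmod (f z) \<le> M * cmod (g z)"
    and x: "0 \<le> x" "x < 1"
  obtains s t where "(\<lambda>k. (cmod (a k))\<^sup>2 * x ^ k) sums s" "(\<lambda>k. (cmod (b k))\<^sup>2 * x ^ k) sums t"
    "s \<le> M\<^sup>2 * t"
proof -
  define \<rho> where "\<rho> = sqrt x"
  have \<rho>: "0 \<le> \<rho>" "\<rho> < 1" "\<rho>\<^sup>2 = x" using x by (simp_all add: \<rho>_def)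
  obtain s where s: "(\<lambda>k. (cmod (a k))\<^sup>2 * x ^ k) sums s"
    "((\<lambda>t. (cmod (f (of_real \<rho> * cis t)))\<^sup>2) has_integral 2 * pi * s) {0..2 * pi}"
    by (rule parseval_circle[OF f \<rho>(1,2), unfolded \<rho>(3)])
  obtain t where t: "(\<lambda>k. (cmod (b k))\<^sup>2 * x ^ k) sums t"
    "((\<lambda>t. (cmod (g (of_real \<rho> * cis t)))\<^sup>2) has_integral 2 * pi * t) {0..2 * pi}"
    by (rule parseval_circle[OF g \<rho>(1,2), unfolded \<rho>(3)])
  have "2 * pi * s \<le> M\<^sup>2 * (2 * pi * t)"
  proof (rule has_integral_le[OF s(2) has_integral_mult_right[OF t(2)]])
    fix u
    have "cmod (f (of_real \<rho> * cis u)) \<le> M * cmod (g (of_real \<rho> * cis u))"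
      using \<rho> by (intro le) (simp add: norm_mult)
    then have "(cmod (f (of_real \<rho> * cis u)))\<^sup>2 \<le> (M * cmod (g (of_real \<rho> * cis u)))\<^sup>2"
      by (intro power_mono) auto
    then show "(cmod (f (of_real \<rho> * cis u)))\<^sup>2 \<le> M\<^sup>2 * (cmod (g (of_real \<rho> * cis u)))\<^sup>2"
      by (simp add: power_mult_distrib)
  qed
  then have "s \<le> M\<^sup>2 * t" by (simp add: mult.left_commute mult.assoc)
  then show thesis using s(1) t(1) that by blast
qed

text \<open>Every partial sum inherits the bound in the limit \<open>x \<rightarrow> 1\<close>, as the terms are nonnegative.\<close>

lemma suminf_le_if_power_series_le:
  fixes \<alpha> :: "nat \<Rightarrow> real"
  assumes nonneg: "\<And>k. 0 \<le> \<alpha> k"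
    and le: "\<And>x. 0 < x \<Longrightarrow> x < 1 \<Longrightarrow> \<exists>s\<le>C. (\<lambda>k. \<alpha> k * x ^ k) sums s"
  shows "summable \<alpha> \<and> suminf \<alpha> \<le> C"
proof -
  have part: "(\<Sum>k<N. \<alpha> k) \<le> C" for N
  proof (rule tendsto_upperbound)
    show "((\<lambda>x. \<Sum>k<N. \<alpha> k * x ^ k) \<longlongrightarrow> (\<Sum>k<N. \<alpha> k)) (at_left (1::real))"
      by (auto intro!: tendsto_eq_intros)
    have "(\<Sum>k<N. \<alpha> k * x ^ k) \<le> C" if x: "0 < x" "x < 1" for x
    proof -
      obtain s where s: "s \<le> C" "(\<lambda>k. \<alpha> k * x ^ k) sums s" using le[OF x] by blast
      have "(\<Sum>k<N. \<alpha> k * x ^ k) \<le> (\<Sum>k. \<alpha> k * x ^ k)"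
        using x nonneg by (intro sum_le_suminf sums_summable[OF s(2)]) auto
      then show ?thesis using s by (simp add: sums_iff)
    qed
    moreover have "eventually (\<lambda>x. x \<in> {0<..<1}) (at_left (1::real))"
      by (rule eventually_at_leftI[of 0]) auto
    ultimately show "\<forall>\<^sub>F x in at_left 1. (\<Sum>k<N. \<alpha> k * x ^ k) \<le> C"
      by (auto elim: eventually_mono)
  qed simp
  have "summable \<alpha>" by (rule summableI_nonneg_bounded[OF nonneg part])
  then show ?thesis using suminf_le_const part by blast
qed

text \<open>
  An inequality between power series, integrated over \<open>[0, 1]\<close>: the function
  \<open>P x = (\<Sum>k. (\<beta> k - \<alpha> k) x\<^sup>k)\<close> vanishes at 0 and has a nonnegative derivative, so it is nonnegative up
  to the boundary.
\<close>

lemma suminf_le_if_derivative_le: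
  fixes \<alpha> \<beta> :: "nat \<Rightarrow> real"
  assumes nonneg: "\<And>k. 0 \<le> \<alpha> k" "\<And>k. 0 \<le> \<beta> k" and \<beta>: "summable \<beta>"
    and le: "\<And>x. 0 \<le> x \<Longrightarrow> x < 1 \<Longrightarrow> \<exists>s t. (\<lambda>k. real k * \<alpha> k * x ^ (k - 1)) sums s \<and>
      (\<lambda>k. real k * \<beta> k * x ^ (k - 1)) sums t \<and> s \<le> t"
    and 0: "\<alpha> 0 = 0" "\<beta> 0 = 0"
  shows "summable \<alpha> \<and> suminf \<alpha> \<le> suminf \<beta>"
proof (rule suminf_le_if_power_series_le)
  show "0 \<le> \<alpha> k" for k by (rule nonneg)
  fix x :: real assume x: "0 < x" "x < 1"
  have \<alpha>_sum: "summable (\<lambda>k. \<alpha> k * y ^ k)" if y: "\<bar>y\<bar> < 1" for y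
  proof (rule summable_comparison_test')
    obtain s where "(\<lambda>k. real k * \<alpha> k * \<bar>y\<bar> ^ (k - 1)) sums s" using le[OF abs_ge_zero y] by blast
    then show "summable (\<lambda>k. real k * \<alpha> k * \<bar>y\<bar> ^ (k - 1))" by (rule sums_summable)
    fix k :: nat assume k: "1 \<le> k"
    have "\<alpha> k * \<bar>y\<bar> ^ k \<le> (real k * \<alpha> k) * \<bar>y\<bar> ^ (k - 1)"
      using k y nonneg(1)[of k]
      by (intro mult_mono power_decreasing) (auto simp: mult_le_cancel_right1)
    then show "norm (\<alpha> k * y ^ k) \<le> real k * \<alpha> k * \<bar>y\<bar> ^ (k - 1)"
      using nonneg(1)[of k] by (simp add: abs_mult power_abs)
  qed
  have \<beta>_le: "\<beta> k * y ^ k \<le> \<beta> k" if "0 \<le> y" "y < 1" for k y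
    using nonneg(2)[of k] that by (simp add: mult_left_le power_le_one)
  have \<beta>_sum: "summable (\<lambda>k. \<beta> k * y ^ k)" if "\<bar>y\<bar> < 1" for y
    by (rule summable_comparison_test'[OF \<beta>, of 0])
       (use that nonneg(2) \<beta>_le[of "\<bar>y\<bar>"] in \<open>simp add: abs_mult power_abs\<close>)
  define P where "P y = (\<Sum>k. (\<beta> k - \<alpha> k) * y ^ k)" for y
  have P_sum: "summable (\<lambda>k. (\<beta> k - \<alpha> k) * y ^ k)" if "\<bar>y\<bar> < 1" for y
    using summable_diff[OF \<beta>_sum[OF that] \<alpha>_sum[OF that]] by (simp add: algebra_simps)
  have P_deriv: "\<exists>D\<ge>0. (P has_real_derivative D) (at y)" if y: "0 \<le> y" "y < 1" for y
  proof -
    obtain s t where st: "(\<lambda>k. real k * \<alpha> k * y ^ (k - 1)) sums s"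
      "(\<lambda>k. real k * \<beta> k * y ^ (k - 1)) sums t" "s \<le> t" using le[OF y] by blast
    have "(\<lambda>k. real k * (\<beta> k - \<alpha> k) * y ^ (k - 1)) sums (t - s)"
      using sums_diff[OF st(2,1)] by (simp add: algebra_simps)
    then have "(\<lambda>k. diffs (\<lambda>k. \<beta> k - \<alpha> k) k * y ^ k) sums (t - s)"
      using sums_Suc_iff[of "\<lambda>k. real k * (\<beta> k - \<alpha> k) * y ^ (k - 1)" "t - s"]
      by (simp add: diffs_def)
    then have D: "(\<Sum>k. diffs (\<lambda>k. \<beta> k - \<alpha> k) k * y ^ k) = t - s" by (rule sums_unique[symmetric])
    have "(P has_real_derivative (t - s)) (at y)"
      unfolding P_def D[symmetric]
      by (rule termdiffs_strong'[of 1]) (use P_sum y in auto)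
    then show ?thesis using st(3) by (intro exI[of _ "t - s"]) auto
  qed
  have "P 0 \<le> P x"
  proof (rule DERIV_nonneg_imp_nondecreasing[of 0 x P])
    show "\<exists>D. (P has_real_derivative D) (at y) \<and> 0 \<le> D" if "0 \<le> y" "y \<le> x" for y
      using P_deriv[of y] that x by auto
  qed (use x in simp)
  moreover have "P 0 = 0"
    unfolding P_def by (simp add: 0)
  moreover have "P x = (\<Sum>k. \<beta> k * x ^ k) - (\<Sum>k. \<alpha> k * x ^ k)"
    unfolding P_def using suminf_diff[OF \<beta>_sum \<alpha>_sum, of x x] x by (simp add: algebra_simps)
  moreover have "(\<Sum>k. \<beta> k * x ^ k) \<le> suminf \<beta>"
    using x by (intro suminf_le \<beta>_le \<beta>_sum \<beta>) auto
  ultimately have "(\<Sum>k. \<alpha> k * x ^ k) \<le> suminf \<beta>" by linarith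
  then show "\<exists>s\<le>suminf \<beta>. (\<lambda>k. \<alpha> k * x ^ k) sums s"
    using summable_sums[OF \<alpha>_sum, of x] x by auto
qed

section \<open>Composition operators on the Hardy and Dirichlet spaces\<close>

interpretation hardy: weighted_hardy_space Rep_hardy "\<lambda>_. 1"
proof
  show "\<exists>f. Rep_hardy f = h" if "h \<in> disc_analytic" "wsummable (\<lambda>_. 1) (taylor_coeff h)" for h
    using Abs_hardy_inverse that unfolding hardy_iff by blast
qed (simp_all add: Rep_hardy_analytic hardy_wsummable Rep_hardy_add Rep_hardy_scaleC
    cinner_hardy_def hardy_cinner_wsum)

interpretation dirichlet: weighted_hardy_space Rep_dirichlet dirichlet_weight
proof
  show "\<exists>f. Rep_dirichlet f = h"
    if "h \<in> disc_analytic" "wsummable dirichlet_weight (taylor_coeff h)" for h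
    using Abs_dirichlet_inverse that unfolding dirichlet_iff by blast
qed (simp_all add: Rep_dirichlet_analytic dirichlet_wsummable Rep_dirichlet_add Rep_dirichlet_scaleC
    cinner_dirichlet_def dirichlet_cinner_wsum)

lemma hardy_norm_le_sup:
  assumes M: "\<And>z. z \<in> ball 0 1 \<Longrightarrow> cmod (Rep_hardy f z) \<le> M"
  shows "norm f \<le> M"
proof -
  have "0 \<le> M" using order_trans[OF norm_ge_zero M[of 0]] by simp
  have "summable (\<lambda>k. (cmod (hardy_coeff f k))\<^sup>2) \<and> (\<Sum>k. (cmod (hardy_coeff f k))\<^sup>2) \<le> M\<^sup>2"
  proof (rule suminf_le_if_power_series_le)
    fix x :: real assume x: "0 < x" "x < 1"
    define b :: "nat \<Rightarrow> complex" where "b k = (if k = 0 then 1 else 0)" for k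
    have b: "(\<lambda>k. b k * z ^ k) sums 1" for z
      using sums_single[of 0 "\<lambda>k. z ^ k"]
      by (simp add: b_def if_distrib[of "\<lambda>c. c * _"] cong: if_cong)
    have "(\<lambda>k. (cmod (b k))\<^sup>2 * x ^ k) sums 1"
      using sums_single[of 0 "\<lambda>k. x ^ k"]
      by (simp add: b_def if_distrib[of cmod] if_distrib[of "\<lambda>c. c\<^sup>2"]
          if_distrib[of "\<lambda>c. c * _"] cong: if_cong)
    moreover obtain s t where "(\<lambda>k. (cmod (hardy_coeff f k))\<^sup>2 * x ^ k) sums s"
      "(\<lambda>k. (cmod (b k))\<^sup>2 * x ^ k) sums t" "s \<le> M\<^sup>2 * t"
      by (rule square_mean_le[of "hardy_coeff f" "Rep_hardy f" b "\<lambda>_. 1" M x])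
         (use taylor_coeff_sums[OF Rep_hardy_analytic] b M x in auto)
    ultimately show "\<exists>s\<le>M\<^sup>2. (\<lambda>k. (cmod (hardy_coeff f k))\<^sup>2 * x ^ k) sums s"
      using sums_unique2 by fastforce
  qed simp
  then show ?thesis
    unfolding norm_hardy_def using \<open>0 \<le> M\<close> by (intro real_le_lsqrt) auto
qed

lemma hardy_trace_class:
  assumes T: "bounded_operator T" and comp: "composition_operator Rep_hardy \<phi> T"
    and \<phi>: "\<phi> ` ball 0 1 \<subseteq> ball 0 1" and r: "disc_sup_norm \<phi> < 1"
  shows "trace_class T"
proof (rule hardy.trace_class_if_summable_norm_monomials[OF T])
  define r where "r = disc_sup_norm \<phi>"
  have \<phi>_le: "cmod (\<phi> z) \<le> r" if "z \<in> ball 0 1" for z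
    unfolding r_def by (rule norm_le_disc_sup_norm[OF \<phi> that])
  have r0: "0 \<le> r" using order_trans[OF norm_ge_zero \<phi>_le[of 0]] by simp
  have le: "norm (T (hardy.monomial n)) \<le> r ^ n" for n
  proof (rule hardy_norm_le_sup)
    fix z :: complex assume z: "z \<in> ball 0 1"
    have "Rep_hardy (T (hardy.monomial n)) z = \<phi> z ^ n"
      using comp z \<phi> by (simp add: composition_operator_def hardy.ev_monomial image_subset_iff)
    then show "cmod (Rep_hardy (T (hardy.monomial n)) z) \<le> r ^ n"
      by (simp add: norm_power power_mono \<phi>_le[OF z])
  qed
  have summ: "summable (\<lambda>n. r ^ n)"
    using r r0 by (intro summable_geometric) (simp add: r_def)
  show "summable (\<lambda>n. norm (T (hardy.monomial n)))"
    by (rule summable_comparison_test'[OF summ, of 0]) (use le in simp)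
qed

lemma taylor_coeff_deriv: "taylor_coeff (deriv f) k = of_nat (Suc k) * taylor_coeff f (Suc k)"
proof -
  have "(deriv ^^ k) (deriv f) = (deriv ^^ Suc k) f" by (simp only: funpow_Suc_right o_apply)
  moreover have "of_nat (Suc k) \<noteq> (0 :: complex)" by (simp only: of_nat_eq_0_iff)
  ultimately show ?thesis by (simp add: taylor_coeff_def fact_Suc del: funpow.simps of_nat_Suc)
qed

text \<open>
  The inequality of square means for the derivatives, integrated over the radius: this is the
  comparison of the area integrals of \<open>\<bar>f'\<bar>\<^sup>2\<close> and \<open>\<bar>g'\<bar>\<^sup>2\<close> in terms of coefficients.
\<close>

lemma dirichlet_integral_le:
  assumes f: "f \<in> disc_analytic" and g: "g \<in> disc_analytic"
    and le: "\<And>z. z \<in> ball 0 1 \<Longrightarrow> cmod (deriv f z) \<le> M * cmod (deriv g z)"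
    and summ: "summable (\<lambda>k. real k * (cmod (taylor_coeff g k))\<^sup>2)"
  shows "(\<Sum>k. real k * (cmod (taylor_coeff f k))\<^sup>2) \<le> M\<^sup>2 * (\<Sum>k. real k * (cmod (taylor_coeff g k))\<^sup>2)"
proof -
  have series: "(\<lambda>k. taylor_coeff (deriv h) k * z ^ k) sums deriv h z"
    if "h \<in> disc_analytic" "z \<in> ball 0 1" for h z
  proof -
    have "deriv h holomorphic_on ball 0 1"
      using that(1) by (intro holomorphic_deriv) (auto simp: disc_analytic_def)
    from holomorphic_power_series[OF this that(2)] show ?thesis by (simp add: taylor_coeff_def)
  qed
  have shift: "(\<lambda>k. real k * (c * (real k * (cmod (taylor_coeff h k))\<^sup>2)) * x ^ (k - 1)) sums (c * s)"
    if "(\<lambda>k. (cmod (taylor_coeff (deriv h) k))\<^sup>2 * x ^ k) sums s" for h c x s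
  proof -
    have "(\<lambda>k. c * ((cmod (taylor_coeff (deriv h) k))\<^sup>2 * x ^ k)) sums (c * s)"
      by (rule sums_mult[OF that])
    then show ?thesis
      using sums_Suc_iff[of "\<lambda>k. real k * (c * (real k * (cmod (taylor_coeff h k))\<^sup>2)) * x ^ (k - 1)" "c * s"]
      by (simp add: taylor_coeff_deriv norm_mult power_mult_distrib power2_eq_square mult_ac
          del: of_nat_Suc)
  qed
  have "summable (\<lambda>k. real k * (cmod (taylor_coeff f k))\<^sup>2) \<and>
      (\<Sum>k. real k * (cmod (taylor_coeff f k))\<^sup>2) \<le> (\<Sum>k. M\<^sup>2 * (real k * (cmod (taylor_coeff g k))\<^sup>2))"
  proof (rule suminf_le_if_derivative_le)
    fix x :: real assume x: "0 \<le> x" "x < 1"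
    obtain s t where "(\<lambda>k. (cmod (taylor_coeff (deriv f) k))\<^sup>2 * x ^ k) sums s"
      "(\<lambda>k. (cmod (taylor_coeff (deriv g) k))\<^sup>2 * x ^ k) sums t" "s \<le> M\<^sup>2 * t"
      by (rule square_mean_le[OF series[OF f] series[OF g] le x])
    then show "\<exists>s t. (\<lambda>k. real k * (real k * (cmod (taylor_coeff f k))\<^sup>2) * x ^ (k - 1)) sums s \<and>
        (\<lambda>k. real k * (M\<^sup>2 * (real k * (cmod (taylor_coeff g k))\<^sup>2)) * x ^ (k - 1)) sums t \<and> s \<le> t"
      using shift[of f x s 1] shift[of g x t "M\<^sup>2"] by (intro exI[of _ s] exI[of _ "M\<^sup>2 * t"]) simp
  qed (auto intro: summable_mult summ)
  then show ?thesis by (simp add: suminf_mult[OF summ])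
qed

text \<open>
  Since \<open>(\<phi>\<^sup>n)' = n \<phi>\<^bsup>n-1\<^esup> \<phi>'\<close>, the area integral of \<open>\<bar>(\<phi>\<^sup>n)'\<bar>\<^sup>2\<close> is at most \<open>(n r\<^bsup>n-1\<^esup>)\<^sup>2\<close> times that
  of \<open>\<bar>\<phi>'\<bar>\<^sup>2\<close>, which is finite: \<open>\<phi>\<close> itself lies in the space, as the image of \<open>id\<close> under \<open>T\<close>.
\<close>

lemma dirichlet_trace_class:
  assumes T: "bounded_operator T" and comp: "composition_operator Rep_dirichlet \<phi> T"
    and \<phi>: "\<phi> ` ball 0 1 \<subseteq> ball 0 1" and r: "disc_sup_norm \<phi> < 1"
  shows "trace_class T"
proof (rule dirichlet.trace_class_if_summable_norm_monomials[OF T])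
  define r where "r = disc_sup_norm \<phi>"
  define F where "F n = Rep_dirichlet (T (dirichlet.monomial n))" for n
  define N where "N = norm (T (dirichlet.monomial 1))"
  have \<phi>_le: "cmod (\<phi> z) \<le> r" if "z \<in> ball 0 1" for z
    unfolding r_def by (rule norm_le_disc_sup_norm[OF \<phi> that])
  have r0: "0 \<le> r" using order_trans[OF norm_ge_zero \<phi>_le[of 0]] by simp
  have F: "F n z = \<phi> z ^ n" if "z \<in> ball 0 1" for n z
    using comp that \<phi> unfolding F_def
    by (simp add: composition_operator_def dirichlet.ev_monomial image_subset_iff)
  have F_analytic: "F n \<in> disc_analytic" for n unfolding F_def by (rule Rep_dirichlet_analytic)
  have F_summ: "summable (\<lambda>k. real k * (cmod (taylor_coeff (F n) k))\<^sup>2)" for n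
    using dirichlet_wsummable[of "T (dirichlet.monomial n)"]
    unfolding F_def dirichlet_wsummable_iff .
  have norm_F: "(norm (T (dirichlet.monomial n)))\<^sup>2 =
      (cmod (taylor_coeff (F n) 0))\<^sup>2 + (\<Sum>k. real k * (cmod (taylor_coeff (F n) k))\<^sup>2)" for n
    unfolding norm_dirichlet_def F_def[symmetric]
    by (intro real_sqrt_pow2 add_nonneg_nonneg suminf_nonneg F_summ) auto
  have deriv_le: "cmod (deriv (F n) z) \<le> real n * r ^ (n - 1) * cmod (deriv (F 1) z)"
    if z: "z \<in> ball 0 1" for n z
  proof -
    have "F 1 field_differentiable at z"
      using F_analytic[of 1] z
      by (auto simp: disc_analytic_def holomorphic_on_imp_differentiable_at)
    then have "(F 1 has_field_derivative deriv (F 1) z) (at z)"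
      by (simp add: DERIV_deriv_iff_field_differentiable)
    then have "((\<lambda>u. F 1 u ^ n) has_field_derivative of_nat n * F 1 z ^ (n - 1) * deriv (F 1) z) (at z)"
      by (auto intro!: derivative_eq_intros)
    then have "(F n has_field_derivative of_nat n * F 1 z ^ (n - 1) * deriv (F 1) z) (at z)"
      by (rule has_field_derivative_transform_within_open[of _ _ _ "ball 0 1"]) (use z in \<open>auto simp: F\<close>)
    then have "deriv (F n) z = of_nat n * \<phi> z ^ (n - 1) * deriv (F 1) z"
      using F[OF z, of 1] by (simp add: DERIV_imp_deriv)
    then show ?thesis
      using \<phi>_le[OF z] by (simp add: norm_mult norm_power mult_left_mono mult_right_mono power_mono)
  qed
  have le: "norm (T (dirichlet.monomial n)) \<le> r ^ n + real n * r ^ (n - 1) * N" for n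
  proof -
    have "taylor_coeff (F n) 0 = \<phi> 0 ^ n" using F[of 0 n] by (simp add: taylor_coeff_def)
    then have "(cmod (taylor_coeff (F n) 0))\<^sup>2 \<le> (r ^ n)\<^sup>2"
      by (simp add: norm_power power_mono \<phi>_le)
    moreover have "(\<Sum>k. real k * (cmod (taylor_coeff (F n) k))\<^sup>2) \<le> (real n * r ^ (n - 1) * N)\<^sup>2"
    proof -
      have "(\<Sum>k. real k * (cmod (taylor_coeff (F n) k))\<^sup>2) \<le>
          (real n * r ^ (n - 1))\<^sup>2 * (\<Sum>k. real k * (cmod (taylor_coeff (F 1) k))\<^sup>2)"
        by (rule dirichlet_integral_le[OF F_analytic F_analytic deriv_le F_summ])
      also have "\<dots> \<le> (real n * r ^ (n - 1))\<^sup>2 * N\<^sup>2"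
        unfolding N_def norm_F by (intro mult_left_mono) auto
      finally show ?thesis by (simp add: power_mult_distrib)
    qed
    ultimately have "(norm (T (dirichlet.monomial n)))\<^sup>2 \<le> (r ^ n)\<^sup>2 + (real n * r ^ (n - 1) * N)\<^sup>2"
      unfolding norm_F by linarith
    also have "\<dots> \<le> (r ^ n + real n * r ^ (n - 1) * N)\<^sup>2"
      using r0 by (simp add: power2_sum N_def)
    finally show ?thesis by (rule power2_le_imp_le) (use r0 in \<open>simp add: N_def\<close>)
  qed
  have summ: "summable (\<lambda>n. r ^ n + real n * r ^ (n - 1) * N)"
  proof (intro summable_add summable_geometric summable_mult2)
    have "summable (\<lambda>n. real (Suc n) * r ^ n)"
      using geometric_deriv_sums[of r] r r0 by (simp add: sums_iff r_def)
    then show "summable (\<lambda>n. real n * r ^ (n - 1))"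
      using summable_Suc_iff[of "\<lambda>n. real n * r ^ (n - 1)"] by simp
  qed (use r r0 in \<open>simp add: r_def\<close>)
  show "summable (\<lambda>n. norm (T (dirichlet.monomial n)))"
    by (rule summable_comparison_test'[OF summ, of 0]) (use le in simp)
qed

theorem theorem3p14:
  fixes \<phi> :: "real \<Rightarrow> complex \<Rightarrow> complex"
  assumes "semiflow \<phi>"
  shows "(\<forall>T :: real \<Rightarrow> hardy \<Rightarrow> hardy.
            (\<forall>t\<ge>0. composition_operator Rep_hardy (\<phi> t) (T t)) \<longrightarrow>
            immediately_compact T \<longrightarrow> analytic_semigroup T \<longrightarrow>
              ((\<exists>t0>0. disc_sup_norm (\<phi> t0) < 1) \<longleftrightarrow> (\<forall>t>0. disc_sup_norm (\<phi> t) < 1)) \<and>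
              ((\<exists>t0>0. disc_sup_norm (\<phi> t0) < 1) \<longrightarrow> immediately_trace_class T)) \<and>
         (\<forall>T :: real \<Rightarrow> dirichlet \<Rightarrow> dirichlet.
            (\<forall>t\<ge>0. composition_operator Rep_dirichlet (\<phi> t) (T t)) \<longrightarrow>
            immediately_compact T \<longrightarrow> analytic_semigroup T \<longrightarrow>
              ((\<exists>t0>0. disc_sup_norm (\<phi> t0) < 1) \<longleftrightarrow> (\<forall>t>0. disc_sup_norm (\<phi> t) < 1)) \<and>
              ((\<exists>t0>0. disc_sup_norm (\<phi> t0) < 1) \<longrightarrow> immediately_trace_class T))"
proof (intro conjI allI impI)
  have \<phi>: "\<phi> t ` ball 0 1 \<subseteq> ball 0 1" if "0 < t" for t
    using assms that by (simp add: semiflow_def)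
  have bounded: "bounded_operator (T t)" if "analytic_semigroup T" "0 < t"
    for T :: "real \<Rightarrow> 'a::complex_hilbert \<Rightarrow> 'a" and t
    using that by (simp add: analytic_semigroup_def C0_semigroup_def)
  {
    fix T :: "real \<Rightarrow> hardy \<Rightarrow> hardy"
    assume comp: "\<forall>t\<ge>0. composition_operator Rep_hardy (\<phi> t) (T t)"
      and an: "analytic_semigroup T"
    have all: "disc_sup_norm (\<phi> t) < 1" if "\<exists>t0>0. disc_sup_norm (\<phi> t0) < 1" "0 < t" for t
      using that hardy.disc_sup_norm_less_1_transfer[where \<phi> = \<phi>, OF an _ \<phi>] comp by auto
    then show "(\<exists>t0>0. disc_sup_norm (\<phi> t0) < 1) \<longleftrightarrow> (\<forall>t>0. disc_sup_norm (\<phi> t) < 1)"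
      using zero_less_one by blast
    show "immediately_trace_class T" if "\<exists>t0>0. disc_sup_norm (\<phi> t0) < 1"
      unfolding immediately_trace_class_def
      using hardy_trace_class[OF bounded[OF an] _ \<phi> all[OF that]] comp less_imp_le by blast
  next
    fix T :: "real \<Rightarrow> dirichlet \<Rightarrow> dirichlet"
    assume comp: "\<forall>t\<ge>0. composition_operator Rep_dirichlet (\<phi> t) (T t)"
      and an: "analytic_semigroup T"
    have all: "disc_sup_norm (\<phi> t) < 1" if "\<exists>t0>0. disc_sup_norm (\<phi> t0) < 1" "0 < t" for t
      using that dirichlet.disc_sup_norm_less_1_transfer[where \<phi> = \<phi>, OF an _ \<phi>] comp by auto
    then show "(\<exists>t0>0. disc_sup_norm (\<phi> t0) < 1) \<longleftrightarrow> (\<forall>t>0. disc_sup_norm (\<phi> t) < 1)"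
      using zero_less_one by blast
    show "immediately_trace_class T" if "\<exists>t0>0. disc_sup_norm (\<phi> t0) < 1"
      unfolding immediately_trace_class_def
      using dirichlet_trace_class[OF bounded[OF an] _ \<phi> all[OF that]] comp less_imp_le by blast
  }
qed

end
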